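(* Let $H\in C^{\infty}(\mathbb{R}^{3})$, let $$\pi\colon T^{*}\mathbb{R}^{2}\to\mathbb{R}^{3},\qquad \pi(q_1,q_2,p_1,p_2)=\frac14\begin{pmatrix}2q_1q_2+2p_1p_2\\ 2q_1p_2-2q_2p_1\\ q_1^2+p_1^2-q_2^2-p_2^2\end{pmatrix},$$ and let $\pi^{*}H:=H\circ\pi$ be the corresponding collective Hamiltonian on $T^{*}\mathbb{R}^{2}$. Then any symplectic Runge--Kutta method $\Phi_h$ applied to the Hamiltonian vector field $X_{\pi^{*}H}$ descends to an integrator $\varphi_h(H)$ on $\mathbb{R}^{3}$, i.e. there is a map $\varphi_h(H)\colon\mathbb{R}^3\to\mathbb{R}^3$ with $\varphi_h(H)\circ\pi=\pi\circ\Phi_h(X_{\pi^{*}H})$, and $\varphi_h(H)$ preserves the Lie--Poisson structure and the coadjoint orbits of $\mathbb{R}^3$. The integrator $\varphi_h(H)$ is consistent with $X_H$ and has the same order of convergence as $\Phi_h$. Moreover, $\varphi_h$ is equivariant with respect to the rotation group $\mathrm{SO}(3)$: $$\varphi_h(g^{*}H)=g^{-1}\circ\varphi_h(H)\circ g$$ for all maps $g(\boldsymbol w):=A\boldsymbol w$ with $A\in\mathrm{SO}(3)$, where $g^{*}H:=H\circ g$.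
   Context: Lie--Poisson structure on $\mathbb{R}^3$: the rigid body bracket $\{F,H\}(\boldsymbol w):=-\boldsymbol w\cdot(\nabla F(\boldsymbol w)\times\nabla H(\boldsymbol w))$; the Hamiltonian vector field of $H$ on $\mathbb{R}^3$ is $X_H(\boldsymbol w):=\boldsymbol w\times\nabla H(\boldsymbol w)$. A map $\varphi\colon\mathbb{R}^3\to\mathbb{R}^3$ preserves the Lie--Poisson structure if $\{F\circ\varphi,H\circ\varphi\}=\{F,H\}\circ\varphi$ for all $F,H\in C^\infty(\mathbb{R}^3)$. The coadjoint orbits are the spheres centred at the origin, together with $\{0\}$; preserving the coadjoint orbits means mapping each of them into itself. Symplectic structure: $T^{*}\mathbb{R}^2\cong\mathbb{R}^4$ carries the canonical symplectic structure, with the sign of the Hamiltonian vector field chosen so that $\pi$ is a Poisson map: the vector field $X_K$ of $K\in C^\infty(T^*\mathbb{R}^2)$ is given by $\dot q_i=-\partial K/\partial p_i$, $\dot p_i=\partial K/\partial q_i$. Runge--Kutta methods: for coefficients $(a_{ij},b_i)_{i,j=1}^s$ with $\sum_i b_i=1$, the method with step size $h$ applied to a vector field $X$ on a vector space $V$ is the map $\Phi_h(X)\colon z\mapsto z+h\sum_i b_iX(Y_i)$, where $Y_i=z+h\sum_j a_{ij}X(Y_j)$. It is understood that $h$ is such that the stage equations define this map, via the solution branching smoothly from $Y_i=z$ at $h=0$. The method is symplectic if $\Phi_h(X_K)$ is a symplectic map for every Hamiltonian $K$ on a symplectic vector space (for irreducible methods: $b_ia_{ij}+b_ja_{ji}=b_ib_j$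 for all $i,j$). A one-step map $\Phi_h(X)$ is an integrator of order $k$ for $X$ if $\Phi_h(X)(z)=\exp(hX)(z)+\mathcal O(h^{k+1})$ as $h\to0$, where $\exp(hX)$ is the time-$h$ flow; it is consistent if it has order at least 1. *)

theory Defs
  imports "HOL-Analysis.Analysis" "HOL-Library.Landau_Symbols"
begin

section \<open>Smooth functions\<close>

text \<open>Meant for finite-dimensional domains, where continuity of all directional derivatives of
  order at most \<open>k\<close> is the same as being \<open>k\<close> times continuously differentiable.\<close>

primrec Ck :: "nat \<Rightarrow> ('a::real_normed_vector \<Rightarrow> 'b::real_normed_vector) \<Rightarrow> bool" where
  "Ck 0 f \<longleftrightarrow> continuous_on UNIV f"
| "Ck (Suc k) f \<longleftrightarrow>
     f differentiable_on UNIV \<and> (\<forall>v. Ck k (\<lambda>x. frechet_derivative f (at x) v))"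

definition smooth :: "('a::real_normed_vector \<Rightarrow> 'b::real_normed_vector) \<Rightarrow> bool" where
  "smooth f \<longleftrightarrow> (\<forall>k. Ck k f)"

definition grad :: "('a::real_inner \<Rightarrow> real) \<Rightarrow> 'a \<Rightarrow> 'a" where
  "grad f x = (THE D. GDERIV f x :> D)"


section \<open>The Lie--Poisson structure of the rigid body\<close>

definition lp_bracket :: "(real^3 \<Rightarrow> real) \<Rightarrow> (real^3 \<Rightarrow> real) \<Rightarrow> real^3 \<Rightarrow> real" where
  "lp_bracket F H w = - (w \<bullet> cross3 (grad F w) (grad H w))"

definition lp_vf :: "(real^3 \<Rightarrow> real) \<Rightarrow> real^3 \<Rightarrow> real^3" where
  "lp_vf H w = cross3 w (grad H w)"

text \<open>Differentiability of \<open>\<phi>\<close> is part of the notion: without it the gradients of \<open>F \<circ> \<phi>\<close> and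
  \<open>H \<circ> \<phi>\<close> need not exist.\<close>

definition preserves_lie_poisson :: "(real^3 \<Rightarrow> real^3) \<Rightarrow> bool" where
  "preserves_lie_poisson \<phi> \<longleftrightarrow>
     \<phi> differentiable_on UNIV \<and>
     (\<forall>F H. smooth F \<longrightarrow> smooth H \<longrightarrow> lp_bracket (F \<circ> \<phi>) (H \<circ> \<phi>) = lp_bracket F H \<circ> \<phi>)"

definition coadjoint_orbits :: "(real^3) set set" where
  "coadjoint_orbits = insert {0} {sphere 0 r | r. r > 0}"

definition preserves_coadjoint_orbits :: "(real^3 \<Rightarrow> real^3) \<Rightarrow> bool" where
  "preserves_coadjoint_orbits \<phi> \<longleftrightarrow> (\<forall>S\<in>coadjoint_orbits. \<phi> ` S \<subseteq> S)"


section \<open>Canonical symplectic structure\<close>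

text \<open>The cotangent bundle of \<open>\<real>\<^sup>n\<close>, with points \<open>(q, p)\<close>.\<close>

type_synonym 'n phase = "(real^'n) \<times> (real^'n)"

definition canonical_form :: "'n::finite phase \<Rightarrow> 'n phase \<Rightarrow> real" where
  "canonical_form u v = fst u \<bullet> snd v - snd u \<bullet> fst v"

definition symplectic_map :: "('n::finite phase \<Rightarrow> 'n phase) \<Rightarrow> bool" where
  "symplectic_map \<Psi> \<longleftrightarrow>
     \<Psi> differentiable_on UNIV \<and>
     (\<forall>z u v. canonical_form (frechet_derivative \<Psi> (at z) u) (frechet_derivative \<Psi> (at z) v)
               = canonical_form u v)"

text \<open>\<open>q' = - \<partial>K/\<partial>p\<close> and \<open>p' = \<partial>K/\<partial>q\<close>, the opposite of the usual sign.\<close>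

definition ham_vf :: "('n::finite phase \<Rightarrow> real) \<Rightarrow> 'n phase \<Rightarrow> 'n phase" where
  "ham_vf K z = (- snd (grad K z), fst (grad K z))"

text \<open>The projection \<open>\<pi>\<close>: the Hopf map, scaled so that \<open>norm (hopf z) = (norm z)\<^sup>2 / 4\<close>.\<close>

definition hopf :: "2 phase \<Rightarrow> real^3" where
  "hopf = (\<lambda>(q, p). (1/4) *\<^sub>R vector
     [2 * q$1 * q$2 + 2 * p$1 * p$2,
      2 * q$1 * p$2 - 2 * q$2 * p$1,
      (q$1)\<^sup>2 + (p$1)\<^sup>2 - (q$2)\<^sup>2 - (p$2)\<^sup>2])"


section \<open>Runge--Kutta methods\<close>

text \<open>A method with \<open>CARD('s)\<close> stages is given by its coefficients \<open>a_ij = A $ i $ j\<close> and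
  \<open>b_i = b $ i\<close>.

  The stages at step size \<open>h\<close> are found by following the solution of the stage equations
  continuously from \<open>Y_i = z\<close> at step size \<open>0\<close> (this initial value is the stage equation at
  \<open>t = 0\<close>) to step size \<open>h\<close>, which may be negative.\<close>

definition rk_branch ::
  "real^'s^'s \<Rightarrow> ('v::euclidean_space \<Rightarrow> 'v) \<Rightarrow> real \<Rightarrow> 'v \<Rightarrow> (real \<Rightarrow> 'v^'s::finite) \<Rightarrow> bool" where
  "rk_branch A X h z Y \<longleftrightarrow>
     continuous_on (closed_segment 0 h) Y \<and>
     (\<forall>t\<in>closed_segment 0 h. \<forall>i. Y t $ i = z + t *\<^sub>R (\<Sum>j\<in>UNIV. A $ i $ j *\<^sub>R X (Y t $ j)))"

definition rk_defined ::
  "real^'s::finite^'s \<Rightarrow> ('v::euclidean_space \<Rightarrow> 'v) \<Rightarrow> real \<Rightarrow> 'v \<Rightarrow> bool" where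
  "rk_defined A X h z \<longleftrightarrow> (\<exists>!y. \<exists>Y. rk_branch A X h z Y \<and> Y h = y)"

definition rk_stages ::
  "real^'s::finite^'s \<Rightarrow> ('v::euclidean_space \<Rightarrow> 'v) \<Rightarrow> real \<Rightarrow> 'v \<Rightarrow> 'v^'s" where
  "rk_stages A X h z = (THE y. \<exists>Y. rk_branch A X h z Y \<and> Y h = y)"

definition rk_map ::
  "real^'s::finite^'s \<Rightarrow> real^'s \<Rightarrow> ('v::euclidean_space \<Rightarrow> 'v) \<Rightarrow> real \<Rightarrow> 'v \<Rightarrow> 'v" where
  "rk_map A b X h z = z + h *\<^sub>R (\<Sum>i\<in>UNIV. b $ i *\<^sub>R X (rk_stages A X h z $ i))"

text \<open>The step sizes for which the method is a (smooth) map on the whole space. For a fixed \<open>z\<close>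
  and a smooth \<open>X\<close>, the method is defined at \<open>z\<close> for all sufficiently small step sizes, but how
  small may depend on \<open>z\<close>; this is why \<open>rk_defined\<close> is kept as a separate, pointwise notion.\<close>

definition rk_admissible ::
  "real^'s::finite^'s \<Rightarrow> ('v::euclidean_space \<Rightarrow> 'v) \<Rightarrow> real \<Rightarrow> bool" where
  "rk_admissible A X h \<longleftrightarrow> (\<forall>z. rk_defined A X h z) \<and> smooth (rk_stages A X h)"

text \<open>Symplecticity on the cotangent bundle of \<open>\<real>\<^sup>n\<close> with \<open>n = CARD('n)\<close>. A method is symplectic
  if this holds for every \<open>n\<close>; that quantifier ranges over types and cannot be written inside a
  formula. Every symplectic vector space is linearly isomorphic to one of these, and Runge--Kutta
  methods commute with linear isomorphisms.\<close>

definition rk_symplectic ::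
  "'n::finite itself \<Rightarrow> real^'s::finite^'s \<Rightarrow> real^'s \<Rightarrow> bool" where
  "rk_symplectic _ A b \<longleftrightarrow>
     (\<forall>K :: 'n phase \<Rightarrow> real. smooth K \<longrightarrow>
        (\<forall>h. rk_admissible A (ham_vf K) h \<longrightarrow> symplectic_map (rk_map A b (ham_vf K) h)))"


section \<open>Order of a one-step map\<close>

definition integral_curve :: "('v::euclidean_space \<Rightarrow> 'v) \<Rightarrow> 'v \<Rightarrow> (real \<Rightarrow> 'v) \<Rightarrow> bool" where
  "integral_curve X z u \<longleftrightarrow>
     u 0 = z \<and> (\<exists>\<epsilon>>0. \<forall>t\<in>{-\<epsilon><..<\<epsilon>}. (u has_vector_derivative X (u t)) (at t))"

text \<open>\<open>u h\<close> is \<open>exp(hX)(z)\<close>; for smooth \<open>X\<close> the germ of \<open>u\<close> at \<open>0\<close> exists and is unique.\<close>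

definition integrator_of_order ::
  "nat \<Rightarrow> (real \<Rightarrow> 'v::euclidean_space \<Rightarrow> 'v) \<Rightarrow> ('v \<Rightarrow> 'v) \<Rightarrow> bool" where
  "integrator_of_order k \<Phi> X \<longleftrightarrow>
     (\<forall>z. \<exists>u. integral_curve X z u \<and>
        (\<lambda>h. norm (\<Phi> h z - u h)) \<in> O[at 0](\<lambda>h. h ^ (k + 1)))"

definition consistent_integrator ::
  "(real \<Rightarrow> 'v::euclidean_space \<Rightarrow> 'v) \<Rightarrow> ('v \<Rightarrow> 'v) \<Rightarrow> bool" where
  "consistent_integrator \<Phi> X \<longleftrightarrow> (\<exists>k\<ge>1. integrator_of_order k \<Phi> X)"

end

theory Submission
  imports Defs
begin

text \<open>
  Identify \<open>T\<^sup>*\<real>\<^sup>2\<close> with \<open>\<complex>\<^sup>2\<close>, a point \<open>(q, p)\<close> being \<open>q + \<i>p\<close>. Then \<open>hopf\<close> is the Hopf map: its fibres are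
  the orbits of the circle acting by a common phase (\<open>hopf_eq_imp_cmul\<close>), and it is a Poisson map
  onto \<open>\<real>\<^sup>3\<close> (\<open>hopf_deriv_imul_adjoint\<close>). Unitary maps of \<open>\<complex>\<^sup>2\<close> descend to linear maps of \<open>\<real>\<^sup>3\<close>, and every
  rotation arises in this way (\<open>hopf_unitary\<close>, \<open>rotation_lift\<close>).

  A Runge--Kutta method commutes with linear changes of variables (\<open>rk_conj\<close>), and a unitary map \<open>U\<close>
  carries the Hamiltonian vector field of \<open>K \<circ> U\<close> to that of \<open>K\<close> (\<open>unitary_ham_vf\<close>). A collective
  Hamiltonian \<open>H \<circ> hopf\<close> is invariant under the circle. So one step \<open>\<Psi>\<close> of the method commutes with the
  circle and descends to a map \<open>\<phi>\<close> of \<open>\<real>\<^sup>3\<close> (\<open>collective_rk_hopf\<close>). Equivariance under rotations is the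
  same fact, applied to a unitary lift of the rotation (\<open>collective_rk_rotation\<close>).

  The geometric properties of \<open>\<phi>\<close> follow from two properties of \<open>\<Psi>\<close>: it is symplectic and it commutes
  with the circle. By a version of Noether's theorem \<open>\<Psi>\<close> preserves the norm, which is the momentum
  of the circle action; since \<open>norm (hopf z) = (norm z)\<^sup>2 / 4\<close>, the map \<open>\<phi>\<close> preserves the spheres. Away from
  the origin \<open>\<phi>\<close> is differentiable since \<open>hopf\<close> has local sections there. At the origin it is
  differentiable because the derivative of \<open>\<Psi>\<close> at 0 is unitary, hence descends to a linear map
  (\<open>descended_differentiable_zero\<close>). Brackets on \<open>\<real>\<^sup>3\<close> can be computed on phase space, where \<open>\<Psi>\<close> preserves
  them (\<open>symplectic_imp_poisson\<close>).

  For the order of accuracy, \<open>hopf\<close> maps the flow of the collective vector field to the flow of the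
  reduced one and is Lipschitz on bounded sets (\<open>collective_rk_order\<close>). Consistency is the case of order
  1, which every method with weights of sum 1 has on phase space. It requires both the
  stages for small step sizes and the exact flow to exist, and each is obtained from the contraction
  principle (\<open>rk_locally_defined\<close>, \<open>picard_lindelof\<close>).
\<close>

section \<open>Gradients and smooth functions\<close>

lemma has_derivative_imp_grad_eq:
  assumes "(f has_derivative (\<lambda>v. v \<bullet> D)) (at x)"
  shows "grad f x = D"
  unfolding grad_def
proof (rule the_equality)
  show "GDERIV f x :> D"
    using assms by (simp add: gderiv_def)
next
  fix D' assume "GDERIV f x :> D'"
  then have "(\<lambda>v. v \<bullet> D') = (\<lambda>v. v \<bullet> D)"
    using assms has_derivative_unique unfolding gderiv_def by blast
  then show "D' = D"
    by (metis vector_eq_ldot)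
qed

lemma has_derivative_grad:
  fixes f :: "'a::euclidean_space \<Rightarrow> real"
  assumes "f differentiable (at x)"
  shows "(f has_derivative (\<lambda>v. v \<bullet> grad f x)) (at x)"
proof -
  obtain f' where f': "(f has_derivative f') (at x)"
    using assms differentiable_def by blast
  have "f' = (\<lambda>v. v \<bullet> adjoint f' 1)"
    using adjoint_works[OF has_derivative_linear[OF f'], of _ 1] by (simp add: fun_eq_iff)
  with f' show ?thesis
    using has_derivative_imp_grad_eq by metis
qed

lemma frechet_derivative_eq_grad:
  fixes f :: "'a::euclidean_space \<Rightarrow> real"
  assumes "f differentiable (at x)"
  shows "frechet_derivative f (at x) v = v \<bullet> grad f x"
  using frechet_derivative_at[OF has_derivative_grad[OF assms]] by metis

text \<open>In this form the chain rule needs no coordinates: all later identities between gradients are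
  identities between adjoints of linear maps.\<close>

lemma grad_compose:
  fixes f :: "'b::euclidean_space \<Rightarrow> real" and g :: "'a::euclidean_space \<Rightarrow> 'b"
  assumes "(g has_derivative g') (at x)" "f differentiable (at (g x))"
  shows "grad (f \<circ> g) x = adjoint g' (grad f (g x))"
proof (rule has_derivative_imp_grad_eq)
  have "((f \<circ> g) has_derivative (\<lambda>v. v \<bullet> grad f (g x)) \<circ> g') (at x)"
    using assms by (intro diff_chain_at has_derivative_grad)
  then show "((f \<circ> g) has_derivative (\<lambda>v. v \<bullet> adjoint g' (grad f (g x)))) (at x)"
    using adjoint_works[OF has_derivative_linear[OF assms(1)]] by (simp add: o_def)
qed

lemma Ck_SucD: "Ck (Suc k) f \<Longrightarrow> Ck k f"
proof (induction k arbitrary: f)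
  case 0
  then show ?case
    by (simp add: differentiable_imp_continuous_on)
next
  case (Suc k)
  then show ?case by (metis Ck.simps(2))
qed

lemma Ck_imp_has_derivative:
  assumes "Ck (Suc k) f"
  shows "(f has_derivative frechet_derivative f (at x)) (at x)"
  using assms frechet_derivative_works by (auto simp: differentiable_on_def)

lemma Ck_SucI:
  assumes "\<And>x. (f has_derivative f' x) (at x)" "\<And>v. Ck k (\<lambda>x. f' x v)"
  shows "Ck (Suc k) f"
proof -
  have "frechet_derivative f (at x) = f' x" for x
    using frechet_derivative_at[OF assms(1)] by metis
  moreover have "f differentiable_on UNIV"
    using assms(1) by (auto simp: differentiable_on_def differentiable_def)
  ultimately show ?thesis
    using assms(2) by simp
qed

lemma Ck_const: "Ck k (\<lambda>x. c)"
proof (induction k arbitrary: c)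
  case (Suc k)
  show ?case by (rule Ck_SucI[where f' = "\<lambda>x v. 0"]) (use Suc in auto)
qed simp

lemma Ck_bounded_linear_compose:
  assumes "bounded_linear T" "Ck k f"
  shows "Ck k (\<lambda>x. T (f x))"
  using assms(2)
proof (induction k arbitrary: f)
  case 0
  then show ?case
    using assms(1) by (simp add: linear_continuous_on bounded_linear.continuous_on)
next
  case (Suc k)
  show ?case
  proof (rule Ck_SucI)
    show "((\<lambda>x. T (f x)) has_derivative (\<lambda>v. T (frechet_derivative f (at x) v))) (at x)" for x
      using bounded_linear.has_derivative[OF assms(1) Ck_imp_has_derivative[OF Suc.prems]] .
    show "Ck k (\<lambda>x. T (frechet_derivative f (at x) v))" for v
      using Suc by auto
  qed
qed

lemma Ck_bounded_linear:
  assumes "bounded_linear T"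
  shows "Ck k T"
proof (cases k)
  case 0
  then show ?thesis
    using assms by (simp add: linear_continuous_on)
next
  case (Suc j)
  have "Ck (Suc j) T"
    by (rule Ck_SucI[where f' = "\<lambda>x. T"])
      (use assms in \<open>auto intro: bounded_linear_imp_has_derivative Ck_const\<close>)
  then show ?thesis using Suc by simp
qed

lemma Ck_add:
  assumes "Ck k f" "Ck k g"
  shows "Ck k (\<lambda>x. f x + g x)"
  using assms
proof (induction k arbitrary: f g)
  case 0
  then show ?case by (simp add: continuous_on_add)
next
  case (Suc k)
  show ?case
  proof (rule Ck_SucI)
    show "((\<lambda>x. f x + g x) has_derivative
        (\<lambda>v. frechet_derivative f (at x) v + frechet_derivative g (at x) v)) (at x)" for x
      using Suc.prems Ck_imp_has_derivative by (intro has_derivative_add)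
    show "Ck k (\<lambda>x. frechet_derivative f (at x) v + frechet_derivative g (at x) v)" for v
      using Suc by auto
  qed
qed

lemma Ck_sum:
  assumes "\<And>i. i \<in> I \<Longrightarrow> Ck k (f i)"
  shows "Ck k (\<lambda>x. \<Sum>i\<in>I. f i x)"
  using assms by (induction I rule: infinite_finite_induct) (auto intro: Ck_const Ck_add)

lemma Ck_mult:
  fixes f g :: "'a::real_normed_vector \<Rightarrow> real"
  assumes "Ck k f" "Ck k g"
  shows "Ck k (\<lambda>x. f x * g x)"
  using assms
proof (induction k arbitrary: f g)
  case 0
  then show ?case by (simp add: continuous_on_mult)
next
  case (Suc k)
  show ?case
  proof (rule Ck_SucI)
    show "((\<lambda>x. f x * g x) has_derivative
        (\<lambda>v. f x * frechet_derivative g (at x) v + frechet_derivative f (at x) v * g x)) (at x)" for x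
      using Suc.prems Ck_imp_has_derivative by (intro has_derivative_mult)
    show "Ck k (\<lambda>x. f x * frechet_derivative g (at x) v + frechet_derivative f (at x) v * g x)" for v
      using Suc Ck_SucD by (intro Ck_add Suc.IH) auto
  qed
qed

text \<open>A directional derivative of \<open>f \<circ> g\<close> is a sum of products of a first derivative of \<open>f\<close>, again
  composed with \<open>g\<close>, and a linear function. So induction on \<open>k\<close> only uses closure under sums and
  products, in place of a chain rule of higher order.\<close>

lemma Ck_compose_quadratic:
  fixes f :: "'b::euclidean_space \<Rightarrow> real" and g :: "'a::euclidean_space \<Rightarrow> 'b"
  assumes "Ck k f" "bounded_bilinear B" "\<And>x. (g has_derivative B x) (at x)"
  shows "Ck k (f \<circ> g)"
  using assms(1)
proof (induction k arbitrary: f)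
  case 0
  moreover have "continuous_on UNIV g"
    using assms(3) by (meson continuous_at_imp_continuous_on has_derivative_continuous)
  ultimately show ?case
    by (simp add: continuous_on_compose2 o_def)
next
  case (Suc k)
  show ?case
  proof (rule Ck_SucI)
    fix x
    have "((f \<circ> g) has_derivative frechet_derivative f (at (g x)) \<circ> B x) (at x)"
      using Ck_imp_has_derivative[OF Suc.prems] assms(3) by (intro diff_chain_at)
    also have "frechet_derivative f (at (g x)) \<circ> B x =
        (\<lambda>v. \<Sum>b\<in>Basis. (frechet_derivative f (at (g x)) b) * (B x v \<bullet> b))"
    proof
      fix v
      have l: "linear (frechet_derivative f (at (g x)))"
        using Ck_imp_has_derivative[OF Suc.prems] has_derivative_linear by blast
      have "frechet_derivative f (at (g x)) (B x v) =
          frechet_derivative f (at (g x)) (\<Sum>b\<in>Basis. (B x v \<bullet> b) *\<^sub>R b)"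
        by (simp add: euclidean_representation)
      also have "\<dots> = (\<Sum>b\<in>Basis. (frechet_derivative f (at (g x)) b) * (B x v \<bullet> b))"
        by (simp add: linear_sum[OF l] linear_cmul[OF l] mult.commute)
      finally show "(frechet_derivative f (at (g x)) \<circ> B x) v =
          (\<Sum>b\<in>Basis. (frechet_derivative f (at (g x)) b) * (B x v \<bullet> b))"
        by simp
    qed
    finally show "((f \<circ> g) has_derivative
      (\<lambda>v. \<Sum>b\<in>Basis. (frechet_derivative f (at (g x)) b) * (B x v \<bullet> b))) (at x)" .
  next
    fix v
    have "Ck k (\<lambda>x. frechet_derivative f (at (g x)) b)" for b
      using Suc.IH[of "\<lambda>y. frechet_derivative f (at y) b"] Suc.prems by (simp add: o_def)
    moreover have "Ck k (\<lambda>x. B x v \<bullet> b)" for b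
    proof (rule Ck_bounded_linear)
      show "bounded_linear (\<lambda>x. B x v \<bullet> b)"
        by (rule bounded_linear_inner_left_comp)
          (rule bounded_bilinear.bounded_linear_left[OF assms(2)])
    qed
    ultimately show "Ck k (\<lambda>x. \<Sum>b\<in>Basis. (frechet_derivative f (at (g x)) b) * (B x v \<bullet> b))"
      by (intro Ck_sum Ck_mult) auto
  qed
qed

text \<open>The derivative is bounded on a ball because it is a finite combination of the directional
  derivatives along the basis, each of which is continuous.\<close>

lemma Ck_1_imp_lipschitz_on_cball:
  fixes f :: "'a::euclidean_space \<Rightarrow> 'b::real_normed_vector"
  assumes "Ck 1 f"
  obtains L where "L-lipschitz_on (cball z r) f"
proof -
  have c: "continuous_on UNIV (\<lambda>x. frechet_derivative f (at x) v)" for v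
    using assms by simp
  have d: "(f has_derivative frechet_derivative f (at x)) (at x)" for x
    using Ck_imp_has_derivative assms by (metis One_nat_def)
  have "compact ((\<lambda>x. \<Sum>b\<in>Basis. norm (frechet_derivative f (at x) b)) ` cball z r)"
    by (intro compact_continuous_image continuous_on_sum continuous_on_norm
        continuous_on_subset[OF c]) auto
  then have "bdd_above ((\<lambda>x. \<Sum>b\<in>Basis. norm (frechet_derivative f (at x) b)) ` cball z r)"
    by (intro bounded_imp_bdd_above compact_imp_bounded)
  then obtain C where C: "\<And>x. x \<in> cball z r \<Longrightarrow> (\<Sum>b\<in>Basis. norm (frechet_derivative f (at x) b)) \<le> C"
    by (auto simp: bdd_above_def simp del: mem_cball)
  have bnd: "onorm (frechet_derivative f (at x)) \<le> C" if "x \<in> cball z r" for x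
  proof (rule onorm_le)
    fix v
    have l: "linear (frechet_derivative f (at x))"
      using d has_derivative_linear by blast
    have "norm (frechet_derivative f (at x) v) =
        norm (frechet_derivative f (at x) (\<Sum>b\<in>Basis. (v \<bullet> b) *\<^sub>R b))"
      by (simp add: euclidean_representation)
    also have "\<dots> = norm (\<Sum>b\<in>Basis. (v \<bullet> b) *\<^sub>R frechet_derivative f (at x) b)"
      by (simp add: linear_sum[OF l] linear_cmul[OF l])
    also have "\<dots> \<le> (\<Sum>b\<in>Basis. norm v * norm (frechet_derivative f (at x) b))"
      by (rule sum_norm_le) (simp add: mult_right_mono Basis_le_norm)
    also have "\<dots> \<le> C * norm v"
      using C[OF that] by (simp flip: sum_distrib_left add: mult.commute[of C] mult_left_mono)
    finally show "norm (frechet_derivative f (at x) v) \<le> C * norm v" .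
  qed
  have "\<bar>C\<bar>-lipschitz_on (cball z r) f"
  proof (rule lipschitz_onI)
    fix x y assume xy: "x \<in> cball z r" "y \<in> cball z r"
    have "norm (f x - f y) \<le> C * norm (x - y)"
      by (rule differentiable_bound[where S = "cball z r" and f' = "\<lambda>x. frechet_derivative f (at x)"])
        (use xy bnd d in \<open>auto intro: has_derivative_at_withinI\<close>)
    also have "\<dots> \<le> \<bar>C\<bar> * norm (x - y)"
      by (simp add: mult_right_mono)
    finally show "dist (f x) (f y) \<le> \<bar>C\<bar> * dist x y"
      by (simp add: dist_norm)
  qed simp
  with that show ?thesis by blast
qed

text \<open>Written out in the basis, the gradient is a combination of directional derivatives. This is
  what makes Hamiltonian vector fields of smooth functions locally Lipschitz.\<close>

lemma Ck_grad:
  fixes f :: "'a::euclidean_space \<Rightarrow> real"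
  assumes "Ck (Suc k) f"
  shows "Ck k (grad f)"
proof -
  have "grad f = (\<lambda>x. \<Sum>b\<in>Basis. frechet_derivative f (at x) b *\<^sub>R b)"
  proof
    fix x
    have "f differentiable (at x)"
      using assms by (auto simp: differentiable_on_def)
    then show "grad f x = (\<Sum>b\<in>Basis. frechet_derivative f (at x) b *\<^sub>R b)"
      by (simp add: frechet_derivative_eq_grad inner_commute[of _ "grad f x"] euclidean_representation)
  qed
  moreover have "Ck k (\<lambda>x. \<Sum>b\<in>Basis. frechet_derivative f (at x) b *\<^sub>R b)"
    using assms
    by (intro Ck_sum Ck_bounded_linear_compose[where T = "\<lambda>r. r *\<^sub>R _"] bounded_linear_scaleR_left) auto
  ultimately show ?thesis by simp
qed

lemma smooth_imp_differentiable: "smooth f \<Longrightarrow> f differentiable (at x)"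
  unfolding smooth_def by (metis Ck.simps(2) UNIV_I differentiable_on_def)

section \<open>The algebra of the Hopf map\<close>

text \<open>Reading \<open>(q, p)\<close> as \<open>q + \<i>p\<close>, this is multiplication by \<open>\<i>\<close>. In these terms Hamiltonian
  vector fields are \<open>\<i>\<close> times gradients, which is why unitary maps carry Hamiltonian vector fields
  to Hamiltonian vector fields.\<close>

definition imul :: "'n::finite phase \<Rightarrow> 'n phase" where
  "imul z = (- snd z, fst z)"

definition cmul :: "complex \<Rightarrow> 'n::finite phase \<Rightarrow> 'n phase" where
  "cmul c z = Re c *\<^sub>R z + Im c *\<^sub>R imul z"

text \<open>The two complex coordinates \<open>q\<^sub>j + \<i>p\<^sub>j\<close> of a point.\<close>

definition spinor :: "complex \<Rightarrow> complex \<Rightarrow> 2 phase" where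
  "spinor a b = (vector [Re a, Re b], vector [Im a, Im b])"

lemma bounded_linear_imul: "bounded_linear imul"
  by (simp add: linear_conv_bounded_linear[symmetric] linear_iff imul_def prod_eq_iff)

lemma imul_add: "imul (x + y) = imul x + imul y"
  and imul_scaleR: "imul (r *\<^sub>R x) = r *\<^sub>R imul x"
  and imul_imul: "imul (imul x) = - x"
  and inner_imul_imul: "imul x \<bullet> imul y = x \<bullet> y"
  by (simp_all add: imul_def prod_eq_iff inner_prod_def inner_commute)

lemma imul_zero: "imul 0 = 0"
  by (simp add: imul_def zero_prod_def)

lemma canonical_form_eq_imul: "canonical_form u v = imul u \<bullet> v"
  by (simp add: canonical_form_def imul_def inner_prod_def)

lemma ham_vf_eq_imul_grad: "ham_vf K z = imul (grad K z)"
  by (simp add: ham_vf_def imul_def)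

lemma spinor_cases: obtains a b where "z = spinor a b"
proof
  show "z = spinor (Complex (fst z $ 1) (snd z $ 1)) (Complex (fst z $ 2) (snd z $ 2))"
    by (simp add: spinor_def prod_eq_iff vec_eq_iff forall_2)
qed

lemma spinor_eq_iff: "spinor a b = spinor c d \<longleftrightarrow> a = c \<and> b = d"
  by (auto simp: spinor_def vec_eq_iff forall_2 complex_eq_iff)

lemma spinor_arith:
  "spinor a b + spinor c d = spinor (a + c) (b + d)"
  "r *\<^sub>R spinor a b = spinor (r *\<^sub>R a) (r *\<^sub>R b)"
  "imul (spinor a b) = spinor (\<i> * a) (\<i> * b)"
  "cmul e (spinor a b) = spinor (e * a) (e * b)"
  by (simp_all add: spinor_def imul_def cmul_def prod_eq_iff vec_eq_iff forall_2)

lemma inner_spinor: "spinor a b \<bullet> spinor c d = Re (cnj a * c + cnj b * d)"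
  by (simp add: spinor_def inner_prod_def inner_vec_def sum_2 algebra_simps)

lemma norm_spinor: "(norm (spinor a b))\<^sup>2 = (cmod a)\<^sup>2 + (cmod b)\<^sup>2"
  unfolding power2_norm_eq_inner[of "spinor a b"] inner_spinor
  by (simp add: cmod_power2 flip: power2_eq_square)

lemma hopf_spinor:
  "hopf (spinor a b) =
    vector [Re (cnj a * b) / 2, Im (cnj a * b) / 2, ((cmod a)\<^sup>2 - (cmod b)\<^sup>2) / 4]"
  by (simp add: hopf_def spinor_def vec_eq_iff forall_3 cmod_power2 field_simps)

lemma norm_vec3: "(norm (w::real^3))\<^sup>2 = (w$1)\<^sup>2 + (w$2)\<^sup>2 + (w$3)\<^sup>2"
  unfolding power2_norm_eq_inner by (simp add: inner_vec_def sum_3 power2_eq_square)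

lemma norm_hopf: "norm (hopf z) = (norm z)\<^sup>2 / 4"
proof (rule power2_eq_imp_eq)
  obtain a b where "z = spinor a b" by (rule spinor_cases)
  then show "(norm (hopf z))\<^sup>2 = ((norm z)\<^sup>2 / 4)\<^sup>2"
    unfolding \<open>z = spinor a b\<close> norm_spinor hopf_spinor norm_vec3 cmod_power2
    by (simp add: power2_eq_square field_simps)
qed auto

lemma hopf_cmul:
  assumes "cmod c = 1"
  shows "hopf (cmul c z) = hopf z"
proof -
  obtain a b where z: "z = spinor a b" by (rule spinor_cases)
  have "cnj (c * a) * (c * b) = (cnj c * c) * (cnj a * b)"
    by (simp add: algebra_simps)
  also have "cnj c * c = 1"
    using assms by (metis complex_norm_square mult.commute of_real_1 power_one)
  finally have "cnj (c * a) * (c * b) = cnj a * b" by simp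
  then show ?thesis
    using assms by (simp only: z spinor_arith hopf_spinor norm_mult) simp
qed

text \<open>The fibres of the Hopf map are circles: the norm of the image fixes \<open>\<bar>a\<bar>\<^sup>2 + \<bar>b\<bar>\<^sup>2\<close> and its
  third component fixes \<open>\<bar>a\<bar>\<^sup>2 - \<bar>b\<bar>\<^sup>2\<close>, hence both moduli, while the other two components fix the
  relative phase of \<open>a\<close> and \<open>b\<close>. Only the common phase remains. A map on phase space that
  commutes with this circle action therefore descends to \<open>\<real>\<^sup>3\<close>.\<close>

lemma hopf_eq_imp_cmul:
  assumes "hopf z = hopf z'"
  obtains c where "cmod c = 1" "z' = cmul c z"
proof -
  obtain a b where z: "z = spinor a b" by (rule spinor_cases)
  obtain a' b' where z': "z' = spinor a' b'" by (rule spinor_cases)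
  have ab: "cnj a * b = cnj a' * b'" and d: "(cmod a)\<^sup>2 - (cmod b)\<^sup>2 = (cmod a')\<^sup>2 - (cmod b')\<^sup>2"
    using assms by (auto simp: z z' hopf_spinor vec_eq_iff forall_3 complex_eq_iff)
  have "(norm z)\<^sup>2 = (norm z')\<^sup>2"
    using assms norm_hopf[of z] norm_hopf[of z'] by simp
  then have "(cmod a)\<^sup>2 + (cmod b)\<^sup>2 = (cmod a')\<^sup>2 + (cmod b')\<^sup>2"
    by (simp add: z z' norm_spinor)
  with d have "(cmod a)\<^sup>2 = (cmod a')\<^sup>2" "(cmod b)\<^sup>2 = (cmod b')\<^sup>2"
    by linarith+
  then have na: "cmod a = cmod a'" and nb: "cmod b = cmod b'"
    by (simp_all add: power2_eq_iff_nonneg)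
  show ?thesis
  proof (cases "a = 0")
    case True
    then have a': "a' = 0" using na by simp
    show ?thesis
    proof (cases "b = 0")
      case True
      then have "z' = cmul 1 z"
        using \<open>a = 0\<close> a' nb by (simp add: z z' spinor_arith)
      then show ?thesis by (intro that[of 1]) auto
    next
      case False
      then have "cmod (b' / b) = 1" "z' = cmul (b' / b) z"
        using \<open>a = 0\<close> a' nb by (auto simp: z z' spinor_arith norm_divide)
      then show ?thesis by (rule that)
    qed
  next
    case False
    then have "a' \<noteq> 0" using na by auto
    have "cnj a * (a' * b) = a' * (cnj a' * b')"
      using ab by (simp add: algebra_simps)
    also have "\<dots> = cnj a * (a * b')"
      using na by (metis complex_norm_square mult.assoc mult.commute)
    finally have "a' * b = a * b'"
      using False by simp
    then have "b' = a' / a * b"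
      using False by (simp add: field_simps)
    then have "cmod (a' / a) = 1" "z' = cmul (a' / a) z"
      using False na by (auto simp: z z' spinor_arith norm_divide)
    then show ?thesis by (rule that)
  qed
qed

lemma differentiable_spinor:
  assumes "a differentiable (at x)" "b differentiable (at x)"
    "c differentiable (at x)" "d differentiable (at x)"
  shows "(\<lambda>w. spinor (Complex (a w) (b w)) (Complex (c w) (d w))) differentiable (at x)"
proof -
  have "(\<lambda>w. spinor (Complex (a w) (b w)) (Complex (c w) (d w))) =
    (\<lambda>w. a w *\<^sub>R spinor 1 0 + b w *\<^sub>R spinor \<i> 0 + c w *\<^sub>R spinor 0 1 + d w *\<^sub>R spinor 0 \<i>)"
    by (auto simp: spinor_arith spinor_eq_iff complex_eq_iff)
  then show ?thesis
    using assms by (simp add: differentiable_add differentiable_scaleR)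
qed

text \<open>Along each fibre the phase can be normalised so that the first coordinate is positive, except
  over the ray where that coordinate vanishes. The other chart normalises the second coordinate.\<close>

lemma hopf_section_north:
  fixes w :: "real^3"
  assumes "norm w + w$3 > 0"
  defines "s \<equiv> sqrt (2 * (norm w + w$3))"
  shows "hopf (spinor (Complex s 0) (Complex (2 * w$1 / s) (2 * w$2 / s))) = w"
proof -
  have s: "s > 0" "s\<^sup>2 = 2 * (norm w + w$3)"
    using assms by simp_all
  have "s\<^sup>2 * s\<^sup>2 - (4 * (w$1)\<^sup>2 + 4 * (w$2)\<^sup>2) = 4 * w$3 * s\<^sup>2"
    using norm_vec3[of w] unfolding s(2) by algebra
  then have "s\<^sup>2 - ((2 * w$1 / s)\<^sup>2 + (2 * w$2 / s)\<^sup>2) = 4 * w$3"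
    using s(1) by (simp add: field_simps power2_eq_square)
  then show ?thesis
    using s(1) by (simp add: hopf_spinor vec_eq_iff forall_3 cmod_power2)
qed

lemma hopf_section_south:
  fixes w :: "real^3"
  assumes "norm w - w$3 > 0"
  defines "s \<equiv> sqrt (2 * (norm w - w$3))"
  shows "hopf (spinor (Complex (2 * w$1 / s) (- (2 * w$2 / s))) (Complex s 0)) = w"
proof -
  have s: "s > 0" "s\<^sup>2 = 2 * (norm w - w$3)"
    using assms by simp_all
  have "(4 * (w$1)\<^sup>2 + 4 * (w$2)\<^sup>2) - s\<^sup>2 * s\<^sup>2 = 4 * w$3 * s\<^sup>2"
    using norm_vec3[of w] unfolding s(2) by algebra
  then have "((2 * w$1 / s)\<^sup>2 + (2 * w$2 / s)\<^sup>2) - s\<^sup>2 = 4 * w$3"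
    using s(1) by (simp add: field_simps power2_eq_square)
  then show ?thesis
    using s(1) by (simp add: hopf_spinor vec_eq_iff forall_3 cmod_power2)
qed

text \<open>The two charts cover the complement of the origin. No continuous section exists near the
  origin or on a whole sphere, so differentiability of descended maps can be read off from sections
  only locally and only away from the origin.\<close>

lemma hopf_local_section:
  fixes w :: "real^3"
  assumes "w \<noteq> 0"
  obtains \<sigma> where "\<sigma> differentiable (at w)" "\<forall>\<^sub>F x in nhds w. hopf (\<sigma> x) = x"
proof -
  have dn: "(\<lambda>x. norm x) differentiable (at w)"
    using assms has_derivative_norm differentiable_def by blast
  have dc: "(\<lambda>x. x $ i) differentiable (at w)" for i :: 3
    using bounded_linear_imp_differentiable bounded_linear_vec_nth by blast
  have ds: "(\<lambda>x. sqrt (f x)) differentiable (at w)"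
    if "f differentiable (at w)" "f w > 0" for f :: "real^3 \<Rightarrow> real"
  proof -
    from that obtain f' where "(f has_derivative f') (at w)"
      using differentiable_def by blast
    from has_derivative_real_sqrt[OF that(2) this] show ?thesis
      using differentiable_def by blast
  qed
  consider "norm w + w$3 > 0" | "norm w - w$3 > 0"
    using assms by (smt (verit) zero_less_norm_iff)
  then show ?thesis
  proof cases
    case 1
    define s where "s x = sqrt (2 * (norm x + x$3))" for x :: "real^3"
    define \<sigma> where "\<sigma> x = spinor (Complex (s x) 0) (Complex (2 * x$1 / s x) (2 * x$2 / s x))" for x
    have "s differentiable (at w)" unfolding s_def
      by (rule ds) (use 1 in \<open>auto intro!: derivative_intros dn dc\<close>)
    moreover have "s w \<noteq> 0" using 1 by (simp add: s_def)
    ultimately have "\<sigma> differentiable (at w)" unfolding \<sigma>_def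
      by (intro differentiable_spinor differentiable_divide differentiable_mult dc differentiable_const) auto
    moreover have "\<forall>\<^sub>F x in nhds w. norm x + x$3 > 0"
    proof -
      have "((\<lambda>x. norm x + x$3) \<longlongrightarrow> norm w + w$3) (nhds w)"
        by (intro tendsto_intros filterlim_ident)
      then show ?thesis using 1 by (rule order_tendstoD)
    qed
    then have "\<forall>\<^sub>F x in nhds w. hopf (\<sigma> x) = x"
      by eventually_elim (simp only: \<sigma>_def s_def hopf_section_north)
    ultimately show ?thesis by (rule that)
  next
    case 2
    define s where "s x = sqrt (2 * (norm x - x$3))" for x :: "real^3"
    define \<sigma> where "\<sigma> x = spinor (Complex (2 * x$1 / s x) (- (2 * x$2 / s x))) (Complex (s x) 0)" for x
    have "s differentiable (at w)" unfolding s_def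
      by (rule ds) (use 2 in \<open>auto intro!: derivative_intros dn dc\<close>)
    moreover have "s w \<noteq> 0" using 2 by (simp add: s_def)
    ultimately have "\<sigma> differentiable (at w)" unfolding \<sigma>_def
      by (intro differentiable_spinor differentiable_minus differentiable_divide differentiable_mult
          dc differentiable_const) auto
    moreover have "\<forall>\<^sub>F x in nhds w. norm x - x$3 > 0"
    proof -
      have "((\<lambda>x. norm x - x$3) \<longlongrightarrow> norm w - w$3) (nhds w)"
        by (intro tendsto_intros filterlim_ident)
      then show ?thesis using 2 by (rule order_tendstoD)
    qed
    then have "\<forall>\<^sub>F x in nhds w. hopf (\<sigma> x) = x"
      by eventually_elim (simp only: \<sigma>_def s_def hopf_section_south)
    ultimately show ?thesis by (rule that)
  qed
qed

lemma surj_hopf: obtains z where "hopf z = w"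
proof (cases "w = 0")
  case True
  then show ?thesis
    using norm_hopf[of 0] that[of 0] by simp
next
  case False
  then obtain \<sigma> where "\<forall>\<^sub>F x in nhds w. hopf (\<sigma> x) = x"
    using hopf_local_section by blast
  then have "hopf (\<sigma> w) = w"
    by (rule eventually_nhds_x_imp_x)
  then show ?thesis by (rule that)
qed


text \<open>The group \<open>U(2)\<close>. It contains both the circle along the fibres of the Hopf map and, via the
  double cover \<open>SU(2) \<rightarrow> SO(3)\<close>, lifts of all rotations of \<open>\<real>\<^sup>3\<close>; this lets one lemma about
  equivariance of Runge--Kutta methods serve for both.\<close>

definition unitary :: "(2 phase \<Rightarrow> 2 phase) \<Rightarrow> bool" where
  "unitary U \<longleftrightarrow> orthogonal_transformation U \<and> (\<forall>z. U (imul z) = imul (U z))"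

lemma unitary_cmul:
  assumes "cmod c = 1"
  shows "unitary (cmul c)"
proof -
  have "linear (cmul c :: 2 phase \<Rightarrow> 2 phase)"
    by (rule linearI) (simp_all add: cmul_def imul_add imul_scaleR algebra_simps)
  moreover have "norm (cmul c z) = norm z" for z :: "2 phase"
  proof (rule power2_eq_imp_eq)
    obtain a b where "z = spinor a b" by (rule spinor_cases)
    then show "(norm (cmul c z))\<^sup>2 = (norm z)\<^sup>2"
      using assms by (simp only: spinor_arith norm_spinor norm_mult) simp
  qed auto
  ultimately show ?thesis
    by (auto simp: unitary_def orthogonal_transformation cmul_def imul_add imul_scaleR)
qed

text \<open>The first column is a unit vector \<open>(s, t)\<close>. In the second column the unit vector orthogonal to \<open>(s, t)\<close> is determined up to the phase
  \<open>e\<close>.\<close>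

lemma unitary_spinorE:
  assumes "unitary U"
  obtains s t e where "(cmod s)\<^sup>2 + (cmod t)\<^sup>2 = 1" "cmod e = 1"
    "\<And>a b. U (spinor a b) = spinor (a * s - b * e * cnj t) (a * t + b * e * cnj s)"
proof -
  have o: "orthogonal_transformation U" and i: "\<And>z. U (imul z) = imul (U z)"
    using assms by (auto simp: unitary_def)
  have l: "linear U" using o by (rule orthogonal_transformation_linear)
  obtain s t where st: "U (spinor 1 0) = spinor s t" by (rule spinor_cases)
  obtain u v where uv: "U (spinor 0 1) = spinor u v" by (rule spinor_cases)
  have n: "(norm (U z))\<^sup>2 = (norm z)\<^sup>2" for z
    using o by (simp add: orthogonal_transformation_norm)
  have 1: "(cmod s)\<^sup>2 + (cmod t)\<^sup>2 = 1" "(cmod u)\<^sup>2 + (cmod v)\<^sup>2 = 1"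
    using n[of "spinor 1 0"] n[of "spinor 0 1"] unfolding st uv norm_spinor by simp_all
  have ip: "U x \<bullet> U y = x \<bullet> y" for x y
    using o unfolding orthogonal_transformation_def by blast
  have "U (spinor 1 0) \<bullet> U (spinor 0 1) = 0" "U (imul (spinor 1 0)) \<bullet> U (spinor 0 1) = 0"
    unfolding ip by (simp_all add: inner_spinor spinor_arith)
  then have 0: "cnj s * u + cnj t * v = 0"
    unfolding i st uv by (simp add: inner_spinor spinor_arith complex_eq_iff)
  define e where "e = s * v - t * u"
  have ss: "s * cnj s + t * cnj t = 1"
    using 1(1) by (metis complex_norm_square of_real_1 of_real_add)
  have v: "v = e * cnj s"
  proof -
    have "e * cnj s = v * (s * cnj s) - t * (cnj s * u)" by (simp add: e_def algebra_simps)
    also have "cnj s * u = - (cnj t * v)" using 0 by (simp add: add_eq_0_iff)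
    also have "v * (s * cnj s) - t * - (cnj t * v) = v * (s * cnj s + t * cnj t)"
      by (simp add: algebra_simps)
    finally show ?thesis using ss by simp
  qed
  have u: "u = - e * cnj t"
  proof -
    have "- e * cnj t = u * (t * cnj t) - s * (cnj t * v)" by (simp add: e_def algebra_simps)
    also have "cnj t * v = - (cnj s * u)" using 0 by (simp add: add_eq_0_iff2)
    also have "u * (t * cnj t) - s * - (cnj s * u) = u * (s * cnj s + t * cnj t)"
      by (simp add: algebra_simps)
    finally show ?thesis using ss by simp
  qed
  have "(cmod e)\<^sup>2 * ((cmod s)\<^sup>2 + (cmod t)\<^sup>2) = 1"
    using 1(2) by (simp add: u v norm_mult power_mult_distrib algebra_simps)
  then have e: "cmod e = 1"
    using 1(1) by (simp add: abs_square_eq_1)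
  have "U (spinor a b) = spinor (a * s - b * e * cnj t) (a * t + b * e * cnj s)" for a b
  proof -
    have "spinor a b = (Re a *\<^sub>R spinor 1 0 + Im a *\<^sub>R imul (spinor 1 0))
        + (Re b *\<^sub>R spinor 0 1 + Im b *\<^sub>R imul (spinor 0 1))"
      by (simp add: spinor_arith spinor_eq_iff complex_eq_iff)
    also have "U \<dots> = cmul a (spinor s t) + cmul b (spinor u v)"
      by (simp add: linear_add[OF l] linear_cmul[OF l] i st uv cmul_def)
    finally show ?thesis
      by (simp add: spinor_arith u v algebra_simps)
  qed
  with 1(1) e that show ?thesis by blast
qed

lemma unitary_spinorI:
  assumes "(cmod s)\<^sup>2 + (cmod t)\<^sup>2 = 1" "cmod e = 1"
  obtains U where "unitary U"
    "\<And>a b. U (spinor a b) = spinor (a * s - b * e * cnj t) (a * t + b * e * cnj s)"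
proof -
  define U :: "2 phase \<Rightarrow> 2 phase" where "U z = cmul (Complex (fst z $ 1) (snd z $ 1)) (spinor s t) +
      cmul (Complex (fst z $ 2) (snd z $ 2)) (spinor (- e * cnj t) (e * cnj s))" for z
  have U: "U (spinor a b) = spinor (a * s - b * e * cnj t) (a * t + b * e * cnj s)" for a b
    unfolding U_def spinor_arith by (simp add: spinor_def[of a b] algebra_simps)
  have "linear U"
  proof (rule linearI)
    fix x y
    obtain a b c d where "x = spinor a b" "y = spinor c d" by (metis spinor_cases)
    then show "U (x + y) = U x + U y"
      by (simp add: spinor_arith U spinor_eq_iff algebra_simps)
  next
    fix r x
    obtain a b where "x = spinor a b" by (metis spinor_cases)
    then show "U (r *\<^sub>R x) = r *\<^sub>R U x"
      by (simp add: spinor_arith U spinor_eq_iff algebra_simps)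
  qed
  moreover have "norm (U z) = norm z" for z :: "2 phase"
  proof (rule power2_eq_imp_eq)
    obtain a b where z: "z = spinor a b" by (rule spinor_cases)
    have "(cmod (a * s - b * e * cnj t))\<^sup>2 + (cmod (a * t + b * e * cnj s))\<^sup>2
        = ((cmod a)\<^sup>2 + (cmod e)\<^sup>2 * (cmod b)\<^sup>2) * ((cmod s)\<^sup>2 + (cmod t)\<^sup>2)"
      unfolding cmod_power2 by (simp, algebra)
    then show "(norm (U z))\<^sup>2 = (norm z)\<^sup>2"
      using assms by (simp add: z U norm_spinor)
  qed auto
  moreover have "U (imul z) = imul (U z)" for z :: "2 phase"
  proof -
    obtain a b where "z = spinor a b" by (rule spinor_cases)
    then show ?thesis by (simp add: spinor_arith U spinor_eq_iff algebra_simps)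
  qed
  ultimately have "unitary U"
    by (auto simp: unitary_def orthogonal_transformation)
  with U that show ?thesis by blast
qed

text \<open>The components of the Hopf map span the Hermitian forms of trace zero, and a unitary change of
  variables preserves the trace; hence composing with it is a linear change of the components. The
  last conclusion says that the frame \<open>R e\<^sub>1, R e\<^sub>2, R e\<^sub>3\<close> is as oriented as the standard one, so that \<open>R\<close> is
  determined by two of its columns.\<close>

lemma hopf_unitary:
  assumes "unitary U"
  obtains R where "linear R" "\<And>z. hopf (U z) = R (hopf z)"
    "cross3 (R (axis 3 1)) (R (axis 1 1)) = R (axis 2 1)"
proof -
  obtain s t e where 1: "(cmod s)\<^sup>2 + (cmod t)\<^sup>2 = 1" "cmod e = 1"
    and U: "\<And>a b. U (spinor a b) = spinor (a * s - b * e * cnj t) (a * t + b * e * cnj s)"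
    using unitary_spinorE[OF assms] by blast
  define m where "m = e * (cnj s)\<^sup>2 - cnj e * t\<^sup>2"
  define n where "n = \<i> * (e * (cnj s)\<^sup>2 + cnj e * t\<^sup>2)"
  define p where "p = - 2 * e * cnj s * cnj t"
  define x :: "real^3" where "x = vector [Re m, Im m, Re p]"
  define y :: "real^3" where "y = vector [Re n, Im n, Re (\<i> * p)]"
  define z :: "real^3" where "z = 4 *\<^sub>R hopf (spinor s t)"
  define R :: "real^3 \<Rightarrow> real^3" where "R w = (w$1) *\<^sub>R x + (w$2) *\<^sub>R y + (w$3) *\<^sub>R z" for w
  have "linear R"
    by (rule linearI) (simp_all add: R_def algebra_simps)
  moreover have "hopf (U v) = R (hopf v)" for v
  proof -
    obtain a b where v: "v = spinor a b" by (rule spinor_cases)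
    define q where "q = cnj a * b"
    define d where "d = (cmod a)\<^sup>2 - (cmod b)\<^sup>2"
    define A where "A = a * s - b * e * cnj t"
    define B where "B = a * t + b * e * cnj s"
    have ee: "cnj e * e = 1" using 1(2) by (metis complex_norm_square mult.commute of_real_1 power_one)
    have d: "of_real d = cnj a * a - cnj b * b"
      unfolding d_def by (simp add: complex_norm_square mult.commute del: of_real_power flip: of_real_power)
    have "cnj A * B = (cnj a * a - cnj b * b * (cnj e * e)) * (cnj s * t)
        + q * (e * (cnj s)\<^sup>2) - cnj q * (cnj e * t\<^sup>2)"
      by (simp add: A_def B_def q_def power2_eq_square algebra_simps)
    also have "\<dots> = of_real (Re q) * m + of_real (Im q) * n + of_real d * (cnj s * t)"
      unfolding ee d m_def n_def by (simp add: complex_eq_iff algebra_simps)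
    finally have AB: "cnj A * B = of_real (Re q) * m + of_real (Im q) * n + of_real d * (cnj s * t)" .
    have AB': "(cmod A)\<^sup>2 - (cmod B)\<^sup>2 =
        2 * Re q * Re p + 2 * Im q * Re (\<i> * p) + d * ((cmod s)\<^sup>2 - (cmod t)\<^sup>2)"
    proof -
      have "(cmod A)\<^sup>2 - (cmod B)\<^sup>2 =
        2 * Re q * Re p + 2 * Im q * Re (\<i> * p) +
        ((cmod a)\<^sup>2 - (cmod e)\<^sup>2 * (cmod b)\<^sup>2) * ((cmod s)\<^sup>2 - (cmod t)\<^sup>2)"
        unfolding A_def B_def q_def p_def cmod_power2 by (simp add: power2_eq_square algebra_simps)
      then show ?thesis using 1(2) by (simp add: d_def)
    qed
    have "hopf (U v) = vector [Re (cnj A * B) / 2, Im (cnj A * B) / 2, ((cmod A)\<^sup>2 - (cmod B)\<^sup>2) / 4]"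
      unfolding v U hopf_spinor A_def B_def ..
    also have "\<dots> = R (vector [Re q / 2, Im q / 2, d / 4])"
      unfolding AB AB' R_def x_def y_def z_def hopf_spinor
      by (simp add: vec_eq_iff forall_3 field_simps)
    also have "vector [Re q / 2, Im q / 2, d / 4] = hopf v"
      unfolding v hopf_spinor q_def d_def ..
    finally show ?thesis .
  qed
  moreover have "cross3 (R (axis 3 1)) (R (axis 1 1)) = R (axis 2 1)"
  proof -
    have "cross3 z x = ((cmod s)\<^sup>2 + (cmod t)\<^sup>2) *\<^sub>R y"
      unfolding hopf_spinor x_def y_def z_def m_def n_def p_def vec_eq_iff forall_3 cmod_power2
      by (simp add: cross3_def power2_eq_square field_simps)
    then have "cross3 z x = y" using 1 by simp
    then show ?thesis by (simp add: R_def axis_def)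
  qed
  ultimately show ?thesis by (rule that)
qed

text \<open>The columns \<open>Q e\<^sub>3\<close> and \<open>Q e\<^sub>1\<close> are lifted to vectors \<open>s\<close> and \<open>t\<close> of squared norms 1 and 2, the
  intended images of \<open>(1, 0)\<close> and \<open>(1, 1)\<close>. Orthogonality of the columns makes the Hermitian product
  of \<open>s\<close> and \<open>t\<close> a phase; once \<open>t\<close> is turned so that this phase is 1, the vectors \<open>s\<close> and \<open>t - s\<close>
  are the columns of a unitary matrix. The remaining column of \<open>Q\<close> then agrees because it is a cross
  product.\<close>

lemma rotation_lift:
  fixes Q :: "real^3^3"
  assumes "rotation_matrix Q"
  obtains U where "unitary U" "\<And>z. hopf (U z) = Q *v hopf z"
proof -
  have oQ: "orthogonal_transformation ((*v) Q)"
    using assms by (simp add: rotation_matrix_def orthogonal_transformation_matrix)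
  obtain s1 s2 where s: "hopf (spinor s1 s2) = Q *v ((1/4) *\<^sub>R axis 3 1)"
    by (metis surj_hopf spinor_cases)
  obtain t1 t2 where t: "hopf (spinor t1 t2) = Q *v ((1/2) *\<^sub>R axis 1 1)"
    by (metis surj_hopf spinor_cases)
  have ns: "(cmod s1)\<^sup>2 + (cmod s2)\<^sup>2 = 1"
    using arg_cong[OF s, of norm] orthogonal_transformation_norm[OF oQ]
    by (simp add: norm_hopf norm_spinor norm_axis_1)
  have nt: "(cmod t1)\<^sup>2 + (cmod t2)\<^sup>2 = 2"
    using arg_cong[OF t, of norm] orthogonal_transformation_norm[OF oQ]
    by (simp add: norm_hopf norm_spinor norm_axis_1)
  define c where "c = cnj s1 * t1 + cnj s2 * t2"
  have "hopf (spinor s1 s2) \<bullet> hopf (spinor t1 t2) = 0"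
    using oQ unfolding s t orthogonal_transformation_def by (simp add: inner_axis_axis)
  \<comment> \<open>The overlap formula for spin states: the Hopf map turns the squared modulus of the
    Hermitian product into an inner product in \<open>\<real>\<^sup>3\<close>.\<close>
  moreover have "2 * (cmod c)\<^sup>2 = ((cmod s1)\<^sup>2 + (cmod s2)\<^sup>2) * ((cmod t1)\<^sup>2 + (cmod t2)\<^sup>2)
     + 16 * (hopf (spinor s1 s2) \<bullet> hopf (spinor t1 t2))"
    unfolding c_def hopf_spinor inner_vec_def sum_3 cmod_power2
    by (simp add: power2_eq_square field_simps)
  ultimately have "(cmod c)\<^sup>2 = 1" using ns nt by simp
  then have c: "cmod c = 1" by (simp add: abs_square_eq_1)
  then have cc: "cnj c * c = 1" by (metis complex_norm_square mult.commute of_real_1 power_one)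
  define e where "e = cnj c * (s1 * t2 - s2 * t1)"
  \<comment> \<open>Lagrange's identity in \<open>\<complex>\<^sup>2\<close>.\<close>
  have "(cmod (s1 * t2 - s2 * t1))\<^sup>2 =
      ((cmod s1)\<^sup>2 + (cmod s2)\<^sup>2) * ((cmod t1)\<^sup>2 + (cmod t2)\<^sup>2) - (cmod c)\<^sup>2"
    unfolding c_def cmod_power2 by (simp add: power2_eq_square field_simps)
  then have "(cmod (s1 * t2 - s2 * t1))\<^sup>2 = 1" using ns nt c by simp
  then have e: "cmod e = 1" using c by (simp add: e_def norm_mult abs_square_eq_1)
  obtain U where U: "unitary U"
    "\<And>a b. U (spinor a b) = spinor (a * s1 - b * e * cnj s2) (a * s2 + b * e * cnj s1)"
    using unitary_spinorI[OF ns e] by blast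
  obtain R where R: "linear R" "\<And>z. hopf (U z) = R (hopf z)"
    "cross3 (R (axis 3 1)) (R (axis 1 1)) = R (axis 2 1)"
    using hopf_unitary[OF U(1)] by blast
  have ss: "s1 * cnj s1 + s2 * cnj s2 = 1"
    using ns by (metis complex_norm_square of_real_1 of_real_add)
  have "s1 - e * cnj s2 = cnj c * t1" "s2 + e * cnj s1 = cnj c * t2"
  proof -
    have "s1 - e * cnj s2 = s1 * (cnj c * c) - e * cnj s2" using cc by simp
    also have "\<dots> = cnj c * t1 * (s1 * cnj s1 + s2 * cnj s2)"
      by (simp add: e_def c_def algebra_simps)
    finally show "s1 - e * cnj s2 = cnj c * t1" using ss by simp
    have "s2 + e * cnj s1 = s2 * (cnj c * c) + e * cnj s1" using cc by simp
    also have "\<dots> = cnj c * t2 * (s1 * cnj s1 + s2 * cnj s2)"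
      by (simp add: e_def c_def algebra_simps)
    finally show "s2 + e * cnj s1 = cnj c * t2" using ss by simp
  qed
  then have "U (spinor 1 1) = cmul (cnj c) (spinor t1 t2)"
    by (simp add: U spinor_arith)
  then have "R (hopf (spinor 1 1)) = Q *v ((1/2) *\<^sub>R axis 1 1)"
    using hopf_cmul[of "cnj c"] c t by (simp flip: R(2))
  moreover have "hopf (spinor 1 1) = (1/2) *\<^sub>R axis 1 1"
    by (simp add: hopf_spinor vec_eq_iff forall_3 axis_def)
  ultimately have R1: "R (axis 1 1) = Q *v axis 1 1"
    by (simp add: linear_cmul[OF R(1)] matrix_vector_mult_scaleR)
  have "R (hopf (spinor 1 0)) = Q *v ((1/4) *\<^sub>R axis 3 1)"
    using s by (simp add: U flip: R(2))
  moreover have "hopf (spinor 1 0) = (1/4) *\<^sub>R axis 3 1"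
    by (simp add: hopf_spinor vec_eq_iff forall_3 axis_def)
  ultimately have R3: "R (axis 3 1) = Q *v axis 3 1"
    by (simp add: linear_cmul[OF R(1)] matrix_vector_mult_scaleR)
  have "R (axis 2 1) = Q *v (cross3 (axis 3 1) (axis 1 1))"
    using R(3) cross_rotation_matrix[OF assms] by (simp add: R1 R3)
  also have "cross3 (axis 3 1) (axis 1 1) = (axis 2 1 :: real^3)"
    by (simp add: cross3_def vec_eq_iff forall_3 axis_def)
  finally have R2: "R (axis 2 1) = Q *v axis 2 1" .
  have "R w = Q *v w" for w
  proof -
    have w: "w = (w$1) *\<^sub>R axis 1 1 + (w$2) *\<^sub>R axis 2 1 + (w$3) *\<^sub>R axis 3 1"
      by (simp add: vec_eq_iff forall_3 axis_def)
    show ?thesis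
      by (subst (1 2) w) (simp add: linear_add[OF R(1)] linear_cmul[OF R(1)]
          matrix_vector_right_distrib matrix_vector_mult_scaleR R1 R2 R3)
  qed
  with U(1) R(2) that show ?thesis by auto
qed

section \<open>The Hopf map is a Poisson map\<close>

text \<open>The polar form of the quadratic map \<open>hopf\<close>, which is also its derivative.\<close>

definition hopf_deriv :: "2 phase \<Rightarrow> 2 phase \<Rightarrow> real^3" where
  "hopf_deriv z v = (1/2) *\<^sub>R vector
     [fst z$1 * fst v$2 + fst z$2 * fst v$1 + snd z$1 * snd v$2 + snd z$2 * snd v$1,
      fst z$1 * snd v$2 + snd z$2 * fst v$1 - fst z$2 * snd v$1 - snd z$1 * fst v$2,
      fst z$1 * fst v$1 + snd z$1 * snd v$1 - fst z$2 * fst v$2 - snd z$2 * snd v$2]"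

lemma bounded_bilinear_hopf_deriv: "bounded_bilinear hopf_deriv"
  unfolding bilinear_conv_bounded_bilinear[symmetric] bilinear_def
  by (auto intro!: linearI simp: hopf_deriv_def vec_eq_iff forall_3 algebra_simps)

lemma hopf_deriv_commute: "hopf_deriv z v = hopf_deriv v z"
  by (simp add: hopf_deriv_def algebra_simps)

lemma hopf_eq_hopf_deriv: "hopf z = (1/2) *\<^sub>R hopf_deriv z z"
  by (simp add: hopf_deriv_def hopf_def vec_eq_iff forall_3 power2_eq_square split: prod.split)

lemma has_derivative_hopf: "(hopf has_derivative hopf_deriv z) (at z)"
proof -
  have "((\<lambda>z. (1/2) *\<^sub>R hopf_deriv z z) has_derivative
      (\<lambda>v. (1/2) *\<^sub>R (hopf_deriv z v + hopf_deriv v z))) (at z)"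
    by (intro has_derivative_scaleR_right bounded_bilinear.FDERIV[OF bounded_bilinear_hopf_deriv]
        has_derivative_ident)
  also have "(\<lambda>v. (1/2) *\<^sub>R (hopf_deriv z v + hopf_deriv v z)) = hopf_deriv z"
    by (rule ext) (simp add: hopf_deriv_commute[of _ z] flip: scaleR_2)
  finally show ?thesis
    by (simp add: hopf_eq_hopf_deriv[abs_def])
qed

lemma linear_hopf_deriv: "linear (hopf_deriv z)"
  using has_derivative_hopf has_derivative_linear by blast

text \<open>This identity is the statement that \<open>hopf\<close> is a Poisson map: the canonical Poisson tensor
  (multiplication by \<open>\<i>\<close>) is pushed forward to the Lie--Poisson tensor. It relates the brackets as well
  as the Hamiltonian vector fields.\<close>

lemma hopf_deriv_imul_adjoint:
  "hopf_deriv z (imul (adjoint (hopf_deriv z) y)) = cross3 (hopf z) y"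
proof -
  define g :: "real^3 \<Rightarrow> 2 phase" where "g y = (1/2) *\<^sub>R
     (vector [fst z$2 * y$1 + snd z$2 * y$2 + fst z$1 * y$3, fst z$1 * y$1 - snd z$1 * y$2 - fst z$2 * y$3],
      vector [snd z$2 * y$1 - fst z$2 * y$2 + snd z$1 * y$3, snd z$1 * y$1 + fst z$1 * y$2 - snd z$2 * y$3])" for y
  have "adjoint (hopf_deriv z) = g"
    by (rule adjoint_unique)
      (simp add: g_def hopf_deriv_def inner_prod_def inner_vec_def sum_2 sum_3 field_simps)
  then show ?thesis
    by (simp add: g_def hopf_deriv_def hopf_def imul_def vec_eq_iff forall_3 cross3_def
        power2_eq_square field_simps split: prod.split)
qed

section \<open>Runge--Kutta methods and linear conjugacy\<close>

lemma rk_branch_conj: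
  assumes "bounded_linear T" "\<And>x. T (X' x) = X (T x)" "rk_branch A X' h z Y"
  shows "rk_branch A X h (T z) (\<lambda>t. \<chi> i. T (Y t $ i))"
proof -
  interpret T: bounded_linear T by fact
  have Y: "continuous_on (closed_segment 0 h) Y"
    "\<And>t i. t \<in> closed_segment 0 h \<Longrightarrow> Y t $ i = z + t *\<^sub>R (\<Sum>j\<in>UNIV. A $ i $ j *\<^sub>R X' (Y t $ j))"
    using assms(3) by (auto simp: rk_branch_def)
  have "T (Y t $ i) = T z + t *\<^sub>R (\<Sum>j\<in>UNIV. A $ i $ j *\<^sub>R X (T (Y t $ j)))"
    if "t \<in> closed_segment 0 h" for t i
    by (subst Y(2)[OF that]) (simp add: T.add T.scaleR T.sum assms(2))
  moreover have "continuous_on (closed_segment 0 h) (\<lambda>t. \<chi> i. T (Y t $ i))"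
    by (intro continuous_on_vec_lambda T.continuous_on continuous_on_component Y(1))
  ultimately show ?thesis
    by (simp add: rk_branch_def)
qed

text \<open>Since \<open>T\<close> is invertible, continuation branches of the stage equations for the two vector fields
  correspond to each other one to one, so that existence and uniqueness of the final stage values are
  transported as well.\<close>

lemma rk_branch_conj_iff:
  fixes T :: "'v::euclidean_space \<Rightarrow> 'v"
  assumes "linear T" "bij T" "\<And>x. T (X' x) = X (T x)"
  shows "(\<exists>Y. rk_branch A X h (T z) Y \<and> Y h = y) \<longleftrightarrow>
    (\<exists>y'. y = (\<chi> i. T (y' $ i)) \<and> (\<exists>Y. rk_branch A X' h z Y \<and> Y h = y'))"
proof
  assume "\<exists>Y. rk_branch A X h (T z) Y \<and> Y h = y"
  then obtain Y where Y: "rk_branch A X h (T z) Y" "Y h = y" by blast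
  have l: "bounded_linear (inv T)"
    using assms by (simp add: linear_conv_bounded_linear[symmetric] inj_linear_imp_inv_linear bij_is_inj)
  have i: "inv T (X x) = X' (inv T x)" for x
    by (metis assms(2,3) bij_inv_eq_iff)
  have "rk_branch A X' h (inv T (T z)) (\<lambda>t. \<chi> i. inv T (Y t $ i))"
    using rk_branch_conj[of "inv T" X X', OF l i Y(1)] .
  then have "\<exists>Y'. rk_branch A X' h z Y' \<and> Y' h = (\<chi> i. inv T (Y h $ i))"
    using assms(2) by (auto simp: bij_is_inj intro!: exI[of _ "\<lambda>t. \<chi> i. inv T (Y t $ i)"])
  moreover have "y = (\<chi> i. T ((\<chi> i. inv T (Y h $ i)) $ i))"
    using assms(2) Y(2) by (simp add: vec_eq_iff bij_is_surj surj_f_inv_f)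
  ultimately show "\<exists>y'. y = (\<chi> i. T (y' $ i)) \<and> (\<exists>Y. rk_branch A X' h z Y \<and> Y h = y')"
    by blast
next
  have "bounded_linear T" using assms(1) by (simp add: linear_conv_bounded_linear)
  then show "\<exists>y'. y = (\<chi> i. T (y' $ i)) \<and> (\<exists>Y. rk_branch A X' h z Y \<and> Y h = y') \<Longrightarrow>
      \<exists>Y. rk_branch A X h (T z) Y \<and> Y h = y"
    using rk_branch_conj[of T X' X A h z] assms(3) by fast
qed

lemma rk_conj:
  fixes T :: "'v::euclidean_space \<Rightarrow> 'v"
  assumes "linear T" "bij T" "\<And>x. T (X' x) = X (T x)" "rk_defined A X' h z"
  shows "rk_defined A X h (T z)"
    and "rk_map A b X h (T z) = T (rk_map A b X' h z)"
proof -
  obtain y' where y': "(\<exists>Y. rk_branch A X' h z Y \<and> Y h = y) \<longleftrightarrow> y = y'" for y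
    using assms(4) unfolding rk_defined_def by (metis (full_types))
  have y: "(\<exists>Y. rk_branch A X h (T z) Y \<and> Y h = y) \<longleftrightarrow> y = (\<chi> i. T (y' $ i))" for y
    using rk_branch_conj_iff[of T X' X A h z, OF assms(1-3)] y' by auto
  show "rk_defined A X h (T z)"
    unfolding rk_defined_def y by blast
  have "rk_stages A X h (T z) = (\<chi> i. T (rk_stages A X' h z $ i))"
    unfolding rk_stages_def y y' by simp
  then show "rk_map A b X h (T z) = T (rk_map A b X' h z)"
    by (simp add: rk_map_def assms(3) linear_add[OF assms(1)] linear_cmul[OF assms(1)]
        linear_sum[OF assms(1)])
qed

section \<open>Local solvability and first-order accuracy\<close>

text \<open>Composing with the projection to the ball makes the vector field bounded and globally
  Lipschitz without changing it near \<open>z\<close>. The fixed-point arguments below can then work on whole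
  spaces, and a posteriori bounds show that the solutions never leave the ball.\<close>

lemma lipschitz_cutoff:
  fixes X :: "'v::euclidean_space \<Rightarrow> 'w::real_normed_vector"
  assumes "L-lipschitz_on (cball z 1) X"
  obtains X' M where "\<And>x. norm (x - z) \<le> 1 \<Longrightarrow> X' x = X x" "L-lipschitz_on UNIV X'"
    "\<And>x. norm (X' x) \<le> M" "M \<ge> 0"
proof -
  define P where "P = closest_point (cball z 1)"
  have P: "P x \<in> cball z 1" "dist (P x) (P y) \<le> dist x y" for x y
    unfolding P_def by (rule closest_point_in_set closest_point_lipschitz; simp)+
  have 1: "X (P x) = X x" if "norm (x - z) \<le> 1" for x
    using that by (simp add: P_def closest_point_self dist_norm norm_minus_commute)
  have L: "L \<ge> 0" using assms by (rule lipschitz_on_nonneg)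
  have 2: "L-lipschitz_on UNIV (\<lambda>x. X (P x))"
  proof (rule lipschitz_onI)
    fix x y
    have "dist (X (P x)) (X (P y)) \<le> L * dist (P x) (P y)"
      using assms P(1) by (auto intro: lipschitz_onD)
    also have "\<dots> \<le> L * dist x y"
      using L P(2) by (intro mult_left_mono)
    finally show "dist (X (P x)) (X (P y)) \<le> L * dist x y" .
  qed fact
  have 3: "norm (X (P x)) \<le> norm (X z) + L" for x
  proof -
    have "dist (X (P x)) (X z) \<le> L * dist (P x) z"
      using assms P(1) by (auto intro: lipschitz_onD)
    also have "\<dots> \<le> L * 1"
      using L P(1)[of x] by (intro mult_left_mono) (auto simp: dist_commute)
    finally show ?thesis
      using norm_triangle_sub[of "X (P x)" "X z"] by (simp add: dist_norm)
  qed
  show ?thesis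
    by (rule that[OF 1 2 3]) (use L in auto)
qed

lemma norm_vec_le_sum: "norm (x :: 'v::real_normed_vector^'s) \<le> (\<Sum>i\<in>UNIV. norm (x $ i))"
  by (simp add: norm_vec_def L2_set_le_sum)

text \<open>For small step sizes the stage equations are a contraction, so they have a unique solution
  which depends on the step size in a Lipschitz way. Another continuous branch cannot escape from it:
  a branch within distance \<open>1/2\<close> of it stays in the ball where the vector field has not been
  modified, hence coincides with it. So the distance takes no value \<open>d\<close> with
  \<open>0 < d \<le> 1/2\<close>, and by connectedness it vanishes throughout.\<close>

lemma rk_locally_defined:
  fixes X :: "'v::euclidean_space \<Rightarrow> 'v" and A :: "real^'s::finite^'s"
  assumes "L-lipschitz_on (cball z 1) X"
  obtains h0 C where "h0 > 0" "C \<ge> 0" "\<And>h. \<bar>h\<bar> \<le> h0 \<Longrightarrow> rk_defined A X h z"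
    "\<And>h i. \<bar>h\<bar> \<le> h0 \<Longrightarrow> norm (rk_stages A X h z $ i - z) \<le> C * \<bar>h\<bar>"
    "\<And>h i. \<bar>h\<bar> \<le> h0 \<Longrightarrow> norm (rk_stages A X h z $ i - z) \<le> 1"
proof -
  obtain X' M where X'1: "\<And>x. norm (x - z) \<le> 1 \<Longrightarrow> X' x = X x"
    and X'2: "L-lipschitz_on UNIV X'" and M: "\<And>x. norm (X' x) \<le> M" "M \<ge> 0"
    using lipschitz_cutoff[OF assms] by blast
  have L: "L \<ge> 0" using assms by (rule lipschitz_on_nonneg)
  define a where "a = (\<Sum>i\<in>UNIV. \<Sum>j\<in>UNIV. \<bar>A $ i $ j\<bar>)"
  have a: "a \<ge> 0" unfolding a_def by (intro sum_nonneg) auto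
  have ai: "(\<Sum>j\<in>UNIV. \<bar>A $ i $ j\<bar>) \<le> a" for i
    unfolding a_def by (rule member_le_sum) (auto intro: sum_nonneg)
  define F where "F t Y = (\<chi> i. z + t *\<^sub>R (\<Sum>j\<in>UNIV. A $ i $ j *\<^sub>R X' (Y $ j)))"
    for t and Y :: "'v^'s"
  have lin: "norm (\<Sum>j\<in>UNIV. A $ i $ j *\<^sub>R V j) \<le> (\<Sum>j\<in>UNIV. \<bar>A $ i $ j\<bar>) * B"
    if "\<And>j. norm (V j) \<le> B" for i B and V :: "'s \<Rightarrow> 'v"
    unfolding sum_distrib_right
    by (rule sum_norm_le) (use that in \<open>auto intro: mult_left_mono\<close>)
  have F1: "norm (F t Y - F t Y') \<le> \<bar>t\<bar> * (a * L) * norm (Y - Y')" for t Y Y'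
  proof -
    have "norm ((F t Y - F t Y') $ i) \<le> \<bar>t\<bar> * ((\<Sum>j\<in>UNIV. \<bar>A $ i $ j\<bar>) * (L * norm (Y - Y')))" for i
    proof -
      have "norm (X' (Y $ j) - X' (Y' $ j)) \<le> L * norm (Y - Y')" for j
      proof -
        have "norm (X' (Y $ j) - X' (Y' $ j)) \<le> L * norm ((Y - Y') $ j)"
          using lipschitz_onD[OF X'2] by (simp add: dist_norm)
        also have "\<dots> \<le> L * norm (Y - Y')"
          using L by (intro mult_left_mono Finite_Cartesian_Product.norm_nth_le)
        finally show ?thesis .
      qed
      then have "\<bar>t\<bar> * norm (\<Sum>j\<in>UNIV. A $ i $ j *\<^sub>R (X' (Y $ j) - X' (Y' $ j))) \<le>
          \<bar>t\<bar> * ((\<Sum>j\<in>UNIV. \<bar>A $ i $ j\<bar>) * (L * norm (Y - Y')))"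
        by (intro mult_left_mono lin) auto
      moreover have "(F t Y - F t Y') $ i = t *\<^sub>R (\<Sum>j\<in>UNIV. A $ i $ j *\<^sub>R (X' (Y $ j) - X' (Y' $ j)))"
        by (simp add: F_def scaleR_diff_right sum_subtractf)
      ultimately show ?thesis by simp
    qed
    then have "(\<Sum>i\<in>UNIV. norm ((F t Y - F t Y') $ i)) \<le>
        (\<Sum>i\<in>UNIV. \<bar>t\<bar> * ((\<Sum>j\<in>UNIV. \<bar>A $ i $ j\<bar>) * (L * norm (Y - Y'))))"
      by (intro sum_mono)
    also have "\<dots> = \<bar>t\<bar> * (a * L) * norm (Y - Y')"
      by (simp add: a_def sum_distrib_left sum_distrib_right mult.assoc)
    finally show ?thesis using norm_vec_le_sum order_trans by blast
  qed
  have F2: "norm (F t Y - F s Y) \<le> \<bar>t - s\<bar> * (a * M)" for t s Y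
  proof -
    have "norm ((F t Y - F s Y) $ i) \<le> \<bar>t - s\<bar> * ((\<Sum>j\<in>UNIV. \<bar>A $ i $ j\<bar>) * M)" for i
    proof -
      have "\<bar>t - s\<bar> * norm (\<Sum>j\<in>UNIV. A $ i $ j *\<^sub>R X' (Y $ j)) \<le> \<bar>t - s\<bar> * ((\<Sum>j\<in>UNIV. \<bar>A $ i $ j\<bar>) * M)"
        using M by (intro mult_left_mono lin) auto
      then show ?thesis
        by (simp add: F_def flip: scaleR_diff_left norm_scaleR)
    qed
    then have "(\<Sum>i\<in>UNIV. norm ((F t Y - F s Y) $ i)) \<le>
        (\<Sum>i\<in>UNIV. \<bar>t - s\<bar> * ((\<Sum>j\<in>UNIV. \<bar>A $ i $ j\<bar>) * M))"
      by (intro sum_mono)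
    also have "\<dots> = \<bar>t - s\<bar> * (a * M)"
      by (simp add: a_def sum_distrib_left sum_distrib_right mult.assoc)
    finally show ?thesis using norm_vec_le_sum order_trans by blast
  qed
  have F0: "norm (F t Y $ i - z) \<le> a * M * \<bar>t\<bar>" for t Y i
  proof -
    have "\<bar>t\<bar> * norm (\<Sum>j\<in>UNIV. A $ i $ j *\<^sub>R X' (Y $ j)) \<le> \<bar>t\<bar> * ((\<Sum>j\<in>UNIV. \<bar>A $ i $ j\<bar>) * M)"
      using M by (intro mult_left_mono lin) auto
    also have "\<dots> \<le> \<bar>t\<bar> * (a * M)"
      using ai M by (intro mult_left_mono mult_right_mono) auto
    finally show ?thesis by (simp add: F_def mult_ac)
  qed
  \<comment> \<open>Chosen such that \<open>F t\<close> has Lipschitz constant at most \<open>1/2\<close> and moves no stage further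
    than \<open>1/2\<close> from \<open>z\<close>; the summand 1 keeps the denominator positive.\<close>
  define h0 where "h0 = 1 / (2 * (a * L + a * M + 1))"
  have pos: "a * L \<ge> 0" "a * M \<ge> 0" using a L M(2) by auto
  have h0: "h0 > 0" using pos by (simp add: h0_def)
  have h: "\<bar>t\<bar> * (a * L) \<le> 1/2" "\<bar>t\<bar> * (a * M) \<le> 1/2" if "\<bar>t\<bar> \<le> h0" for t
  proof -
    have *: "h0 * (a * L + a * M + 1) = 1/2" using pos by (simp add: h0_def)
    have "\<bar>t\<bar> * (a * L) \<le> h0 * (a * L + a * M + 1)" "\<bar>t\<bar> * (a * M) \<le> h0 * (a * L + a * M + 1)"
      using that pos h0 by (auto intro!: mult_mono)
    then show "\<bar>t\<bar> * (a * L) \<le> 1/2" "\<bar>t\<bar> * (a * M) \<le> 1/2" unfolding * .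
  qed
  have contr: "norm (F t Y - F t Y') \<le> 1/2 * norm (Y - Y')" if "\<bar>t\<bar> \<le> h0" for t Y Y'
    using F1[of t Y Y'] mult_right_mono[OF h(1)[OF that], of "norm (Y - Y')"] by simp
  have ex1: "\<exists>!Y. F t Y = Y" if "\<bar>t\<bar> \<le> h0" for t
    by (rule banach_fix_type[where c = "1/2"]) (use contr[OF that] in \<open>auto simp: dist_norm\<close>)
  define y where "y t = (THE Y. F t Y = Y)" for t
  have y: "F t (y t) = y t" "F t Y = Y \<Longrightarrow> Y = y t" if "\<bar>t\<bar> \<le> h0" for t Y
    using theI'[OF ex1[OF that]] ex1[OF that] unfolding y_def[symmetric] by blast+
  have yz: "norm (y t $ i - z) \<le> a * M * \<bar>t\<bar>" "norm (y t $ i - z) \<le> 1/2" if "\<bar>t\<bar> \<le> h0" for t i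
    using F0[of t "y t" i] h(2)[OF that] by (simp_all add: y(1)[OF that] mult_ac)
  have ylip: "norm (y t - y s) \<le> 2 * (a * M) * \<bar>t - s\<bar>" if "\<bar>t\<bar> \<le> h0" "\<bar>s\<bar> \<le> h0" for t s
  proof -
    have "norm (y t - y s) = norm ((F t (y t) - F t (y s)) + (F t (y s) - F s (y s)))"
      using y that by simp
    also have "\<dots> \<le> 1/2 * norm (y t - y s) + \<bar>t - s\<bar> * (a * M)"
      by (intro norm_triangle_mono contr F2 that)
    finally show ?thesis by (simp add: mult_ac)
  qed
  have seg: "\<bar>t\<bar> \<le> h0" if "t \<in> closed_segment 0 h" "\<bar>h\<bar> \<le> h0" for t h :: real
    using that by (auto simp: closed_segment_eq_real_ivl split: if_splits)
  have ycont: "continuous_on (closed_segment 0 h) y" if "\<bar>h\<bar> \<le> h0" for h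
  proof -
    have "(2 * (a * M))-lipschitz_on (closed_segment 0 h) y"
      by (rule lipschitz_onI) (use ylip seg that pos in \<open>auto simp: dist_norm\<close>)
    then show ?thesis by (rule lipschitz_on_continuous_on)
  qed
  have ybranch: "rk_branch A X h z y" if "\<bar>h\<bar> \<le> h0" for h
    unfolding rk_branch_def
  proof (intro conjI ballI allI ycont that)
    fix t i assume "t \<in> closed_segment 0 h"
    then have t: "\<bar>t\<bar> \<le> h0" using seg that by blast
    have "X' (y t $ j) = X (y t $ j)" for j
      using X'1 yz(2)[OF t, of j] by simp
    moreover have "F t (y t) $ i = y t $ i" using y(1)[OF t] by simp
    ultimately show "y t $ i = z + t *\<^sub>R (\<Sum>j\<in>UNIV. A $ i $ j *\<^sub>R X (y t $ j))"
      by (simp add: F_def)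
  qed
  have yuniq: "Y h = y h" if hh: "\<bar>h\<bar> \<le> h0" and Y: "rk_branch A X h z Y" for h Y
  proof (rule ccontr)
    assume ne: "Y h \<noteq> y h"
    define D where "D t = norm (Y t - y t)" for t
    have D: "D t = 0" if t: "t \<in> closed_segment 0 h" and small: "D t \<le> 1/2" for t
    proof -
      have "norm (Y t $ j - z) \<le> 1" for j
      proof -
        have "norm (Y t $ j - z) \<le> norm ((Y t - y t) $ j) + norm (y t $ j - z)"
          using norm_triangle_ineq[of "(Y t - y t) $ j" "y t $ j - z"] by simp
        also have "\<dots> \<le> D t + 1/2"
          unfolding D_def using yz(2)[OF seg[OF t hh]] by (intro add_mono Finite_Cartesian_Product.norm_nth_le)
        finally show ?thesis using small by simp
      qed
      then have "X' (Y t $ j) = X (Y t $ j)" for j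
        by (rule X'1)
      moreover have "\<forall>i. Y t $ i = z + t *\<^sub>R (\<Sum>j\<in>UNIV. A $ i $ j *\<^sub>R X (Y t $ j))"
        using Y t unfolding rk_branch_def by blast
      ultimately have "\<forall>i. F t (Y t) $ i = Y t $ i"
        unfolding F_def by (metis (no_types, lifting) sum.cong vec_lambda_beta)
      then have "F t (Y t) = Y t" by (rule vec_eq_iff[THEN iffD2])
      then show ?thesis
        using y(2)[OF seg[OF t hh]] by (simp add: D_def)
    qed
    have c: "continuous_on (closed_segment 0 h) D"
      unfolding D_def using Y ycont[OF hh]
      by (intro continuous_intros) (auto simp: rk_branch_def)
    have "Y 0 = y 0"
    proof -
      have "Y 0 $ i = z + 0 *\<^sub>R (\<Sum>j\<in>UNIV. A $ i $ j *\<^sub>R X (Y 0 $ j))" for i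
        using Y unfolding rk_branch_def by (metis ends_in_segment(1))
      moreover have "y 0 $ i = z" for i
        using yz(1)[of 0 i] h0 by simp
      ultimately show ?thesis by (simp add: vec_eq_iff)
    qed
    then have D0: "D 0 = 0" by (simp add: D_def)
    have Dh: "D h > 0" using ne by (simp add: D_def)
    have "connected (D ` closed_segment 0 h)"
      using c by (rule connected_continuous_image) simp
    moreover have "0 \<in> D ` closed_segment 0 h" using D0 by (metis ends_in_segment(1) image_eqI)
    ultimately have "{0..D h} \<subseteq> D ` closed_segment 0 h"
      by (intro connected_contains_Icc) auto
    then have "min (1/2) (D h) \<in> D ` closed_segment 0 h"
      using Dh by (auto simp: min_def)
    then obtain t where "t \<in> closed_segment 0 h" "D t = min (1/2) (D h)" by force
    with D[of t] Dh show False by (auto simp: min_def split: if_splits)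
  qed
  have iff: "(\<exists>Y. rk_branch A X h z Y \<and> Y h = v) \<longleftrightarrow> v = y h" if "\<bar>h\<bar> \<le> h0" for h v
    using yuniq ybranch that by blast
  have st: "rk_stages A X h z = y h" if "\<bar>h\<bar> \<le> h0" for h
    unfolding rk_stages_def iff[OF that] by simp
  show ?thesis
  proof (rule that[OF h0 pos(2)])
    fix h i assume h: "\<bar>h\<bar> \<le> h0"
    show "rk_defined A X h z"
      unfolding rk_defined_def iff[OF h] by blast
    show "norm (rk_stages A X h z $ i - z) \<le> a * M * \<bar>h\<bar>" "norm (rk_stages A X h z $ i - z) \<le> 1"
      using yz[OF h, of i] by (simp_all add: st[OF h])
  qed
qed

text \<open>The stages differ from \<open>z\<close> by \<open>O(h)\<close>, so the slopes differ from \<open>X z\<close> by \<open>O(h)\<close>, and the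
  weights sum up to 1.\<close>

lemma rk_map_first_order:
  fixes X :: "'v::euclidean_space \<Rightarrow> 'v" and A :: "real^'s::finite^'s"
  assumes "L-lipschitz_on (cball z 1) X" "(\<Sum>i\<in>UNIV. b $ i) = 1"
  shows "(\<lambda>h. norm (rk_map A b X h z - (z + h *\<^sub>R X z))) \<in> O[at 0](\<lambda>h. h ^ 2)"
proof -
  obtain h0 C where h0: "h0 > 0" and C: "C \<ge> 0"
    and st: "\<And>h i. \<bar>h\<bar> \<le> h0 \<Longrightarrow> norm (rk_stages A X h z $ i - z) \<le> C * \<bar>h\<bar>"
      "\<And>h i. \<bar>h\<bar> \<le> h0 \<Longrightarrow> norm (rk_stages A X h z $ i - z) \<le> 1"
    using rk_locally_defined[OF assms(1)] by metis
  have L: "L \<ge> 0" using assms(1) by (rule lipschitz_on_nonneg)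
  define B where "B = (\<Sum>i\<in>UNIV. \<bar>b $ i\<bar> * (L * C))"
  have "norm (rk_map A b X h z - (z + h *\<^sub>R X z)) \<le> B * norm (h ^ 2)" if h: "\<bar>h\<bar> \<le> h0" for h
  proof -
    let ?Y = "\<lambda>i. rk_stages A X h z $ i"
    have "norm (X (?Y i) - X z) \<le> L * C * \<bar>h\<bar>" for i
    proof -
      have "norm (X (?Y i) - X z) \<le> L * norm (?Y i - z)"
        using lipschitz_onD[OF assms(1), of "?Y i" z] st(2)[OF h, of i]
        by (simp add: dist_norm norm_minus_commute)
      also have "\<dots> \<le> L * (C * \<bar>h\<bar>)"
        using st(1)[OF h] L by (intro mult_left_mono)
      finally show ?thesis by simp
    qed
    then have "norm (\<Sum>i\<in>UNIV. b $ i *\<^sub>R (X (?Y i) - X z)) \<le> (\<Sum>i\<in>UNIV. \<bar>b $ i\<bar> * (L * C * \<bar>h\<bar>))"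
      by (intro sum_norm_le) (simp add: mult_left_mono)
    also have "\<dots> = B * \<bar>h\<bar>"
      by (simp add: B_def sum_distrib_left sum_distrib_right mult_ac)
    finally have *: "norm (\<Sum>i\<in>UNIV. b $ i *\<^sub>R (X (?Y i) - X z)) \<le> B * \<bar>h\<bar>" .
    have "rk_map A b X h z - (z + h *\<^sub>R X z) =
        h *\<^sub>R ((\<Sum>i\<in>UNIV. b $ i *\<^sub>R X (?Y i)) - (\<Sum>i\<in>UNIV. b $ i) *\<^sub>R X z)"
      by (simp add: rk_map_def assms(2) algebra_simps)
    also have "\<dots> = h *\<^sub>R (\<Sum>i\<in>UNIV. b $ i *\<^sub>R (X (?Y i) - X z))"
      by (simp add: scaleR_sum_left sum_subtractf scaleR_diff_right)
    finally show ?thesis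
      using mult_left_mono[OF *, of "\<bar>h\<bar>"] by (simp add: power2_eq_square abs_mult mult_ac)
  qed
  moreover have "\<forall>\<^sub>F h in at 0. \<bar>h\<bar> \<le> h0"
    unfolding eventually_at using h0 by (intro exI[of _ h0]) (auto simp: dist_norm)
  ultimately show ?thesis
    by (intro bigoI[where c = B]) (auto elim: eventually_mono)
qed

lemma vector_derivative_bound:
  fixes u :: "real \<Rightarrow> 'v::real_normed_vector"
  assumes "\<And>t. t \<in> S \<Longrightarrow> (u has_vector_derivative u' t) (at t)" "\<And>t. t \<in> S \<Longrightarrow> norm (u' t) \<le> B"
    "convex S" "s \<in> S" "t \<in> S"
  shows "norm (u t - u s) \<le> B * \<bar>t - s\<bar>"
proof -
  have "norm (u t - u s) \<le> B * norm (t - s)"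
  proof (rule differentiable_bound[OF \<open>convex S\<close>])
    show "(u has_derivative (\<lambda>h. h *\<^sub>R u' x)) (at x within S)" if "x \<in> S" for x
      using assms(1)[OF that] unfolding has_vector_derivative_def by (rule has_derivative_at_withinI)
    show "onorm (\<lambda>h. h *\<^sub>R u' x) \<le> B" if "x \<in> S" for x
    proof (rule onorm_le)
      show "norm (h *\<^sub>R u' x) \<le> B * norm h" for h
        using mult_left_mono[OF assms(2)[OF that], of "\<bar>h\<bar>"] by (simp add: mult_ac)
    qed
  qed (use assms in auto)
  then show ?thesis by simp
qed

text \<open>Local existence of integral curves by the contraction principle, needed because consistency
  asserts that the exact flow exists.\<close>

lemma picard_lindelof:
  fixes X :: "'v::euclidean_space \<Rightarrow> 'v"
  assumes "L-lipschitz_on UNIV X" "\<And>x. norm (X x) \<le> M"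
  obtains \<epsilon> u where "\<epsilon> > 0" "u 0 = z"
    "\<And>t. t \<in> {-\<epsilon><..<\<epsilon>} \<Longrightarrow> (u has_vector_derivative X (u t)) (at t)"
proof -
  have L: "L \<ge> 0" using assms(1) by (rule lipschitz_on_nonneg)
  have Xc: "continuous_on UNIV X" using assms(1) by (rule lipschitz_on_continuous_on)
  define \<epsilon> where "\<epsilon> = 1 / (6 * (L + 1))"
  have \<epsilon>: "\<epsilon> > 0" "3 * \<epsilon> * L \<le> 1/2"
    using L by (auto simp: \<epsilon>_def field_simps)
  \<comment> \<open>The Picard operator. Integrating from \<open>-\<epsilon>\<close> and subtracting the value at 0 treats both signs
    of \<open>t\<close> at once; the two integrals have total length at most \<open>3\<epsilon>\<close>, whence the choice of \<open>\<epsilon>\<close>.\<close>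
  define g where "g u t = z + integral {-\<epsilon>..t} (\<lambda>s. X (apply_bcontfun u s))
      - integral {-\<epsilon>..0} (\<lambda>s. X (apply_bcontfun u s))" for u :: "real \<Rightarrow>\<^sub>C 'v" and t
  have Xu: "continuous_on S (\<lambda>s. X (apply_bcontfun u s))" for u :: "real \<Rightarrow>\<^sub>C 'v" and S
    by (rule continuous_on_compose2[OF Xc]) auto
  have gd: "(g u has_vector_derivative X (u t)) (at t within {-\<epsilon>..\<epsilon>})" if "t \<in> {-\<epsilon>..\<epsilon>}" for u t
    unfolding g_def by (auto intro!: derivative_eq_intros integral_has_vector_derivative Xu that)
  have gc: "continuous_on {-\<epsilon>..\<epsilon>} (g u)" for u
    by (rule continuous_on_vector_derivative) (rule gd)
  \<comment> \<open>The contraction acts on bounded continuous functions on the whole line, extended by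
    constants outside the interval.\<close>
  have "\<exists>v::real \<Rightarrow>\<^sub>C 'v. \<forall>x. v x = g u (clamp (-\<epsilon>) \<epsilon> x)" for u
    using continuous_on_cbox_bcontfunE[of "-\<epsilon>" \<epsilon> "g u"] gc by (metis cbox_interval)
  then obtain T :: "(real \<Rightarrow>\<^sub>C 'v) \<Rightarrow> real \<Rightarrow>\<^sub>C 'v" where T: "\<And>u x. T u x = g u (clamp (-\<epsilon>) \<epsilon> x)"
    by metis
  have gdiff: "dist (g u t) (g v t) \<le> 1/2 * dist u v" if t: "t \<in> {-\<epsilon>..\<epsilon>}" for u v t
  proof -
    let ?f = "\<lambda>s. X (apply_bcontfun u s) - X (apply_bcontfun v s)"
    have b: "norm (?f s) \<le> L * dist u v" for s
    proof -
      have "norm (?f s) \<le> L * dist (u s) (v s)"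
        using lipschitz_onD[OF assms(1)] by (simp add: dist_norm)
      also have "\<dots> \<le> L * dist u v"
        using L dist_bounded by (intro mult_left_mono)
      finally show ?thesis .
    qed
    have i: "norm (integral {-\<epsilon>..r} ?f) \<le> L * dist u v * (r - - \<epsilon>)" if "-\<epsilon> \<le> r" for r
      by (rule integral_bound) (use that b in \<open>auto intro!: continuous_on_diff Xu\<close>)
    have d: "integral {-\<epsilon>..r} ?f =
        integral {-\<epsilon>..r} (\<lambda>s. X (apply_bcontfun u s)) - integral {-\<epsilon>..r} (\<lambda>s. X (apply_bcontfun v s))" for r
      by (intro integral_diff integrable_continuous_real Xu)
    have "g u t - g v t = integral {-\<epsilon>..t} ?f - integral {-\<epsilon>..0} ?f"
      unfolding d g_def by simp
    then have "dist (g u t) (g v t) \<le> norm (integral {-\<epsilon>..t} ?f) + norm (integral {-\<epsilon>..0} ?f)"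
      by (simp add: dist_norm norm_triangle_ineq4)
    also have "\<dots> \<le> L * dist u v * (t - - \<epsilon>) + L * dist u v * (0 - - \<epsilon>)"
      using t \<epsilon>(1) by (intro add_mono i) auto
    also have "\<dots> \<le> L * dist u v * (2 * \<epsilon>) + L * dist u v * \<epsilon>"
      using t L by (intro add_mono mult_left_mono) auto
    also have "\<dots> = (3 * \<epsilon> * L) * dist u v" by (simp add: algebra_simps)
    also have "\<dots> \<le> 1/2 * dist u v"
      using \<epsilon>(2) by (intro mult_right_mono) auto
    finally show ?thesis .
  qed
  have "dist (T u) (T v) \<le> 1/2 * dist u v" for u v
  proof (rule dist_bound)
    fix x
    have "clamp (-\<epsilon>) \<epsilon> x \<in> {-\<epsilon>..\<epsilon>}"
      using clamp_in_interval[of "-\<epsilon>" \<epsilon> x] \<epsilon>(1) by simp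
    then show "dist (T u x) (T v x) \<le> 1/2 * dist u v"
      unfolding T by (rule gdiff)
  qed
  then have "\<exists>!u. T u = u"
    by (intro banach_fix_type[where c = "1/2"]) auto
  then obtain u where u: "T u = u" by blast
  have ug: "u t = g u t" if "t \<in> {-\<epsilon>..\<epsilon>}" for t
    using T[of u t] that by (simp add: u clamp_cancel_cbox)
  show ?thesis
  proof (rule that[OF \<epsilon>(1)])
    show "u 0 = z" using ug[of 0] \<epsilon>(1) by (simp add: g_def)
    fix t assume t: "t \<in> {-\<epsilon><..<\<epsilon>}"
    then have "(u has_vector_derivative X (u t)) (at t within {-\<epsilon>..\<epsilon>})"
      using gd[of t u] ug has_vector_derivative_transform[of t "{-\<epsilon>..\<epsilon>}" u "g u"] by auto
    then show "(u has_vector_derivative X (u t)) (at t)"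
      using t by (simp add: at_within_Icc_at)
  qed
qed

lemma integral_curve_first_order:
  fixes X :: "'v::euclidean_space \<Rightarrow> 'v"
  assumes "L-lipschitz_on (cball z 1) X"
  obtains u where "integral_curve X z u"
    "(\<lambda>h. norm (u h - (z + h *\<^sub>R X z))) \<in> O[at 0](\<lambda>h. h ^ 2)"
proof -
  obtain X' M where X'1: "\<And>x. norm (x - z) \<le> 1 \<Longrightarrow> X' x = X x"
    and X'2: "L-lipschitz_on UNIV X'" and M: "\<And>x. norm (X' x) \<le> M" "M \<ge> 0"
    using lipschitz_cutoff[OF assms] by blast
  have L: "L \<ge> 0" using assms by (rule lipschitz_on_nonneg)
  obtain \<epsilon> u where u: "\<epsilon> > 0" "u 0 = z"
    "\<And>t. t \<in> {-\<epsilon><..<\<epsilon>} \<Longrightarrow> (u has_vector_derivative X' (u t)) (at t)"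
    using picard_lindelof[OF X'2 M(1)] by metis
  have uz: "norm (u t - z) \<le> M * \<bar>t\<bar>" if "t \<in> {-\<epsilon><..<\<epsilon>}" for t
    using vector_derivative_bound[of "{-\<epsilon><..<\<epsilon>}" u "\<lambda>t. X' (u t)" M 0 t] u M that by simp
  define \<delta> where "\<delta> = min \<epsilon> (1 / (M + 1))"
  have \<delta>: "\<delta> > 0" using u(1) M(2) by (simp add: \<delta>_def)
  have \<delta>M: "M * \<bar>t\<bar> \<le> 1" if "\<bar>t\<bar> < \<delta>" for t
  proof -
    have "M * \<bar>t\<bar> \<le> (M + 1) * (1 / (M + 1))"
      using that M(2) by (intro mult_mono) (auto simp: \<delta>_def)
    then show ?thesis using M(2) by simp
  qed
  have du: "(u has_vector_derivative X (u t)) (at t)" if "\<bar>t\<bar> < \<delta>" for t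
  proof -
    have t: "t \<in> {-\<epsilon><..<\<epsilon>}" using that by (auto simp: \<delta>_def)
    then have "norm (u t - z) \<le> 1" using uz[OF t] \<delta>M[OF that] by simp
    then show ?thesis using u(3)[OF t] X'1 by simp
  qed
  have "integral_curve X z u"
    unfolding integral_curve_def using u(2) \<delta> du by (auto intro!: exI[of _ \<delta>])
  moreover have "norm (u h - (z + h *\<^sub>R X z)) \<le> (L * M) * norm (h ^ 2)" if h: "\<bar>h\<bar> < \<delta>" for h
  proof -
    have "norm ((u h - h *\<^sub>R X z) - (u 0 - 0 *\<^sub>R X z)) \<le> (L * M * \<bar>h\<bar>) * \<bar>h - 0\<bar>"
    proof (rule vector_derivative_bound)
      fix t assume t: "t \<in> {-\<bar>h\<bar>..\<bar>h\<bar>}"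
      then have t': "\<bar>t\<bar> < \<delta>" "\<bar>t\<bar> \<le> \<bar>h\<bar>" using h by auto
      show "((\<lambda>h. u h - h *\<^sub>R X z) has_vector_derivative (X (u t) - X z)) (at t)"
        by (auto intro!: derivative_eq_intros du t')
      have t'': "t \<in> {-\<epsilon><..<\<epsilon>}" using t'(1) by (auto simp: \<delta>_def)
      have "norm (u t - z) \<le> 1" using uz[OF t''] \<delta>M[OF t'(1)] by simp
      then have "norm (X (u t) - X z) \<le> L * norm (u t - z)"
        using lipschitz_onD[OF assms, of "u t" z] by (simp add: dist_norm norm_minus_commute)
      also have "\<dots> \<le> L * (M * \<bar>h\<bar>)"
        using uz[OF t''] t'(2) M(2) L by (intro mult_left_mono order_trans[OF uz[OF t'']]) auto
      finally show "norm (X (u t) - X z) \<le> L * M * \<bar>h\<bar>" by simp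
    qed auto
    then show ?thesis
      using u(2) by (simp add: algebra_simps power2_eq_square abs_mult)
  qed
  then have "(\<lambda>h. norm (u h - (z + h *\<^sub>R X z))) \<in> O[at 0](\<lambda>h. h ^ 2)"
    using \<delta> by (intro bigoI[where c = "L * M"]) (auto simp: eventually_at dist_norm intro!: exI[of _ \<delta>])
  ultimately show ?thesis by (rule that)
qed

text \<open>The method and the flow have the same expansion \<open>z + h X z + O(h\<^sup>2)\<close>.\<close>

lemma rk_consistent:
  fixes X :: "'v::euclidean_space \<Rightarrow> 'v" and A :: "real^'s::finite^'s"
  assumes "\<And>z. \<exists>L. L-lipschitz_on (cball z 1) X" "(\<Sum>i\<in>UNIV. b $ i) = 1"
  shows "integrator_of_order 1 (rk_map A b X) X"
  unfolding integrator_of_order_def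
proof
  fix z
  obtain L where L: "L-lipschitz_on (cball z 1) X" using assms(1) by blast
  obtain u where u: "integral_curve X z u"
    "(\<lambda>h. norm (u h - (z + h *\<^sub>R X z))) \<in> O[at 0](\<lambda>h. h ^ 2)"
    using integral_curve_first_order[OF L] by blast
  let ?e = "\<lambda>h. norm (rk_map A b X h z - (z + h *\<^sub>R X z)) + norm (u h - (z + h *\<^sub>R X z))"
  have e: "?e \<in> O[at 0](\<lambda>h. h ^ 2)"
    by (intro sum_in_bigo rk_map_first_order[OF L assms(2)] u(2))
  have "norm (rk_map A b X h z - u h) \<le> ?e h" for h
    by (metis dist_norm dist_triangle2)
  then have "(\<lambda>h. norm (rk_map A b X h z - u h)) \<in> O[at 0](\<lambda>h. h ^ 2)"
    by (intro landau_o.big_trans[OF landau_o.big_mono e]) simp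
  with u(1) show "\<exists>u. integral_curve X z u \<and>
      (\<lambda>h. norm (rk_map A b X h z - u h)) \<in> O[at 0](\<lambda>h. h ^ (1 + 1))"
    by (auto simp: numeral_2_eq_2)
qed

section \<open>Collective Hamiltonian vector fields\<close>

text \<open>Points of phase space are treated as vectors here; splitting quantifiers over them into
  pairs would keep facts about vectors from matching.\<close>

declare split_paired_All [simp del] split_paired_Ex [simp del]

lemma hopf_diff: "hopf x - hopf y = (1/2) *\<^sub>R hopf_deriv (x + y) (x - y)"
  by (simp add: hopf_eq_hopf_deriv hopf_deriv_commute[of y x]
      bounded_bilinear.add_left[OF bounded_bilinear_hopf_deriv]
      bounded_bilinear.diff_right[OF bounded_bilinear_hopf_deriv] algebra_simps)

lemma smooth_compose_hopf:
  fixes H :: "real^3 \<Rightarrow> real"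
  shows "smooth H \<Longrightarrow> smooth (H \<circ> hopf)"
  unfolding smooth_def
  by (intro allI Ck_compose_quadratic[OF _ bounded_bilinear_hopf_deriv has_derivative_hopf]) blast

lemma differentiable_compose_hopf:
  "f differentiable (at (hopf z)) \<Longrightarrow> (f \<circ> hopf) differentiable (at z)"
  using has_derivative_hopf differentiable_def by (blast intro: differentiable_chain_at)

lemma ham_vf_lipschitz:
  fixes K :: "'n::finite phase \<Rightarrow> real"
  assumes "smooth K"
  obtains L where "L-lipschitz_on (cball z 1) (ham_vf K)"
proof -
  have "Ck 1 (grad K)"
    using assms unfolding smooth_def by (intro Ck_grad) blast
  then have "Ck 1 (\<lambda>x. imul (grad K x))"
    by (rule Ck_bounded_linear_compose[OF bounded_linear_imul])
  then have "Ck 1 (ham_vf K)"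
    by (simp only: ham_vf_eq_imul_grad[abs_def])
  then show ?thesis
    using Ck_1_imp_lipschitz_on_cball that by blast
qed

text \<open>Hence \<open>hopf\<close> maps integral curves of the collective vector field to integral curves of the
  reduced one.\<close>

lemma hopf_related_vector_fields:
  assumes "H differentiable (at (hopf z))"
  shows "hopf_deriv z (ham_vf (H \<circ> hopf) z) = lp_vf H (hopf z)"
  using assms
  by (simp add: ham_vf_eq_imul_grad grad_compose[OF has_derivative_hopf] hopf_deriv_imul_adjoint lp_vf_def)

lemma lp_bracket_hopf:
  assumes "f differentiable (at (hopf z))" "g differentiable (at (hopf z))"
  shows "lp_bracket f g (hopf z) = grad (f \<circ> hopf) z \<bullet> imul (grad (g \<circ> hopf) z)"
proof -
  let ?P = "hopf_deriv z" and ?a = "grad f (hopf z)" and ?c = "grad g (hopf z)"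
  have "adjoint ?P ?a \<bullet> imul (adjoint ?P ?c) = ?a \<bullet> cross3 (hopf z) ?c"
    by (simp add: adjoint_clauses[OF linear_hopf_deriv] hopf_deriv_imul_adjoint)
  also have "\<dots> = - (hopf z \<bullet> cross3 ?a ?c)"
    by (simp add: cross3_def inner_vec_def sum_3 algebra_simps)
  finally show ?thesis
    using assms by (simp add: lp_bracket_def grad_compose[OF has_derivative_hopf])
qed

lemma unitary_adjoint:
  assumes "unitary U"
  shows "U (adjoint U y) = y"
proof -
  have o: "orthogonal_transformation U" using assms by (simp add: unitary_def)
  obtain w where w: "y = U w" using orthogonal_transformation_surj[OF o] by (metis surjD)
  have "x \<bullet> adjoint U (U w) = x \<bullet> w" for x
    using o by (simp add: adjoint_clauses orthogonal_transformation_def)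
  then have "adjoint U (U w) = w" by (metis vector_eq_ldot)
  then show ?thesis by (simp add: w)
qed

text \<open>The gradient of \<open>K \<circ> U\<close> is the gradient of \<open>K\<close> pulled back by the inverse of \<open>U\<close>, and \<open>U\<close>
  commutes with \<open>\<i>\<close>.\<close>

lemma unitary_ham_vf:
  assumes "unitary U" "K differentiable (at (U z))"
  shows "U (ham_vf (K \<circ> U) z) = ham_vf K (U z)"
proof -
  have "linear U"
    using assms(1) by (simp add: unitary_def orthogonal_transformation_linear)
  then have "(U has_derivative U) (at z)"
    by (simp add: linear_imp_has_derivative)
  then have "grad (K \<circ> U) z = adjoint U (grad K (U z))"
    using assms(2) by (rule grad_compose)
  then show ?thesis
    using assms(1) unitary_adjoint[OF assms(1)] by (simp add: ham_vf_eq_imul_grad unitary_def)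
qed

lemma rk_unitary:
  assumes "unitary U" "\<And>z. K differentiable (at z)"
  shows "rk_defined A (ham_vf (K \<circ> U)) h z \<longleftrightarrow> rk_defined A (ham_vf K) h (U z)"
    and "rk_defined A (ham_vf (K \<circ> U)) h z \<Longrightarrow>
      rk_map A b (ham_vf K) h (U z) = U (rk_map A b (ham_vf (K \<circ> U)) h z)"
proof -
  have o: "orthogonal_transformation U" using assms(1) by (simp add: unitary_def)
  have U: "linear U" "bij U"
    using o by (simp_all add: orthogonal_transformation_linear orthogonal_transformation_bij)
  have c: "U (ham_vf (K \<circ> U) x) = ham_vf K (U x)" for x
    using assms by (rule unitary_ham_vf)
  have U': "linear (inv U)" "bij (inv U)"
    using orthogonal_transformation_inv[OF o] U(2)
    by (simp_all add: orthogonal_transformation_linear bij_imp_bij_inv)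
  have c': "inv U (ham_vf K x) = ham_vf (K \<circ> U) (inv U x)" for x
    by (metis U(2) c bij_inv_eq_iff)
  show "rk_defined A (ham_vf (K \<circ> U)) h z \<longleftrightarrow> rk_defined A (ham_vf K) h (U z)"
  proof
    show "rk_defined A (ham_vf K) h (U z)" if "rk_defined A (ham_vf (K \<circ> U)) h z"
      using rk_conj(1)[of U "ham_vf (K \<circ> U)" "ham_vf K", OF U c that] .
    show "rk_defined A (ham_vf (K \<circ> U)) h z" if "rk_defined A (ham_vf K) h (U z)"
      using rk_conj(1)[of "inv U" "ham_vf K" "ham_vf (K \<circ> U)", OF U' c' that] U(2)
      by (simp add: bij_is_inj)
  qed
  show "rk_map A b (ham_vf K) h (U z) = U (rk_map A b (ham_vf (K \<circ> U)) h z)"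
    if "rk_defined A (ham_vf (K \<circ> U)) h z"
    using rk_conj(2)[of U "ham_vf (K \<circ> U)" "ham_vf K", OF U c that] .
qed

section \<open>Symplectic maps commuting with the circle action\<close>

text \<open>Preserving the form is the matrix identity \<open>S\<^sup>T J S = J\<close>, preserving the Poisson tensor is
  \<open>S J S\<^sup>T = J\<close>. The former exhibits \<open>- J S\<^sup>T J\<close> as a left inverse of \<open>S\<close>, which in finite dimension is
  a right inverse too, and that is the latter.\<close>

lemma symplectic_imp_poisson:
  fixes S :: "'n::finite phase \<Rightarrow> 'n phase"
  assumes "linear S" "\<And>u v. canonical_form (S u) (S v) = canonical_form u v"
  shows "adjoint S x \<bullet> imul (adjoint S y) = x \<bullet> imul y"
proof -
  have adj: "adjoint S (imul (S u)) = imul u" for u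
  proof -
    have "adjoint S (imul (S u)) \<bullet> v = imul u \<bullet> v" for v
      using assms(2)[of u v] by (simp add: canonical_form_eq_imul adjoint_clauses[OF assms(1)])
    then show ?thesis by (metis vector_eq_rdot)
  qed
  have "inj S"
  proof (rule injI)
    fix u v assume "S u = S v"
    then have "imul (imul u) = imul (imul v)" using adj by metis
    then show "u = v" by (simp add: imul_imul)
  qed
  then obtain u where u: "imul y = S u"
    using assms(1) linear_injective_imp_surjective by (metis surjD)
  have y: "y = - imul (S u)" using imul_imul[of y] u by simp
  have "adjoint S y = - imul u"
    using linear_neg[OF adjoint_linear[OF assms(1)]] by (simp add: y adj)
  moreover have "imul (- imul u) = u"
    using linear_neg[OF bounded_linear.linear[OF bounded_linear_imul], of "imul u"]
    by (simp add: imul_imul)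
  ultimately show ?thesis
    by (simp add: adjoint_clauses[OF assms(1)] u)
qed

text \<open>The two properties of a Runge--Kutta step for a collective Hamiltonian from which the geometric
  properties of the descended map follow.\<close>

locale circle_symplectic =
  fixes \<Psi> :: "2 phase \<Rightarrow> 2 phase"
  assumes symplectic: "symplectic_map \<Psi>"
    and equivariant: "\<And>c z. cmod c = 1 \<Longrightarrow> \<Psi> (cmul c z) = cmul c (\<Psi> z)"
begin

abbreviation D where "D z \<equiv> frechet_derivative \<Psi> (at z)"

lemma has_derivative: "(\<Psi> has_derivative D z) (at z)"
  using symplectic unfolding symplectic_map_def
  by (simp add: differentiable_on_def flip: frechet_derivative_works)

lemma linear_D: "linear (D z)"
  using has_derivative has_derivative_linear by blast

lemma canonical_form_D: "canonical_form (D z u) (D z v) = canonical_form u v"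
  using symplectic by (simp add: symplectic_map_def)

lemma zero: "\<Psi> 0 = 0"
proof -
  have "\<Psi> 0 = - \<Psi> 0"
    using equivariant[of "- 1" 0] by (simp add: cmul_def imul_zero)
  then have "2 *\<^sub>R \<Psi> 0 = 0" by (simp add: scaleR_2 eq_neg_iff_add_eq_0)
  then show ?thesis by simp
qed

text \<open>Derivative of the equivariance along the circle, at the angle 0.\<close>

lemma D_imul_self: "D z (imul z) = imul (\<Psi> z)"
proof -
  have d: "((\<lambda>\<theta>. cmul (cis \<theta>) x) has_derivative (\<lambda>t. t *\<^sub>R imul x)) (at 0)" for x :: "2 phase"
    unfolding cmul_def by (auto intro!: derivative_eq_intros)
  have "((\<Psi> \<circ> (\<lambda>\<theta>. cmul (cis \<theta>) z)) has_derivative (D z \<circ> (\<lambda>t. t *\<^sub>R imul z))) (at 0)"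
    by (rule diff_chain_at[OF d]) (use has_derivative in \<open>simp add: cmul_def\<close>)
  also have "\<Psi> \<circ> (\<lambda>\<theta>. cmul (cis \<theta>) z) = (\<lambda>\<theta>. cmul (cis \<theta>) (\<Psi> z))"
    by (auto simp: equivariant)
  finally have "D z \<circ> (\<lambda>t. t *\<^sub>R imul z) = (\<lambda>t. t *\<^sub>R imul (\<Psi> z))"
    using d has_derivative_unique by blast
  from fun_cong[OF this, of 1] show ?thesis by simp
qed

text \<open>Noether's theorem for maps: pairing with the generator \<open>\<i>z\<close> of the circle action turns
  preservation of the symplectic form into the equality of the derivatives of \<open>\<bar>\<Psi> z\<bar>\<^sup>2\<close> and \<open>\<bar>z\<bar>\<^sup>2\<close>. So the
  momentum map \<open>\<bar>z\<bar>\<^sup>2 / 2\<close> changes by a constant, and that constant is 0 because the only fixed point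
  of the circle, the origin, is mapped to itself.\<close>

lemma norm_preserving: "norm (\<Psi> z) = norm z"
proof -
  have radial: "D z v \<bullet> \<Psi> z = v \<bullet> z" for v z
    using canonical_form_D[of z v "imul z"]
    by (simp add: canonical_form_eq_imul D_imul_self inner_imul_imul)
  have "((\<lambda>z. \<Psi> z \<bullet> \<Psi> z - z \<bullet> z) has_derivative (\<lambda>v. 0)) (at z)" for z
  proof -
    have "((\<lambda>z. \<Psi> z \<bullet> \<Psi> z - z \<bullet> z) has_derivative
        (\<lambda>v. (\<Psi> z \<bullet> D z v + D z v \<bullet> \<Psi> z) - (z \<bullet> v + v \<bullet> z))) (at z)"
      by (intro has_derivative_diff has_derivative_inner has_derivative has_derivative_ident)
    then show ?thesis
      using radial by (simp add: inner_commute)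
  qed
  then obtain C where C: "\<And>x. \<Psi> x \<bullet> \<Psi> x - x \<bullet> x = C"
    using has_derivative_zero_constant[of UNIV "\<lambda>z. \<Psi> z \<bullet> \<Psi> z - z \<bullet> z"] by auto
  show ?thesis
    using C[of z] C[of 0] by (simp add: zero norm_eq)
qed

text \<open>At the origin the derivative inherits the full equivariance, so it commutes with \<open>\<i>\<close>; a complex
  linear symplectic map is unitary.\<close>

lemma unitary_D_zero: "unitary (D 0)"
proof -
  have m: "imul = (cmul \<i> :: 2 phase \<Rightarrow> 2 phase)" by (rule ext) (simp add: cmul_def)
  have dm: "((\<lambda>x. imul x) has_derivative imul) (at x)" for x :: "2 phase"
    using bounded_linear_imul by (rule bounded_linear_imp_has_derivative)
  have "((\<Psi> \<circ> imul) has_derivative (D 0 \<circ> imul)) (at 0)"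
    by (rule diff_chain_at[OF dm]) (use has_derivative in \<open>simp add: imul_zero\<close>)
  moreover have "((imul \<circ> \<Psi>) has_derivative (imul \<circ> D 0)) (at 0)"
    by (rule diff_chain_at[OF has_derivative dm])
  moreover have "\<Psi> \<circ> imul = imul \<circ> \<Psi>"
    by (auto simp: m equivariant)
  ultimately have "D 0 \<circ> imul = imul \<circ> D 0"
    using has_derivative_unique by metis
  then have i: "D 0 (imul z) = imul (D 0 z)" for z by (metis o_apply)
  have "D 0 u \<bullet> D 0 v = u \<bullet> v" for u v
    using canonical_form_D[of 0 u "imul v"] by (simp add: canonical_form_eq_imul i inner_imul_imul)
  then show ?thesis
    by (simp add: unitary_def orthogonal_transformation_def linear_D i)
qed

context
  fixes \<phi> assumes descends: "\<And>z. \<phi> (hopf z) = hopf (\<Psi> z)"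
begin

lemma descended_norm: "norm (\<phi> w) = norm w"
  by (metis descends norm_hopf norm_preserving surj_hopf)

lemma descended_preserves_coadjoint_orbits: "preserves_coadjoint_orbits \<phi>"
proof -
  have "\<phi> 0 = 0" using descended_norm[of 0] by simp
  then show ?thesis
    by (auto simp: preserves_coadjoint_orbits_def coadjoint_orbits_def descended_norm)
qed

text \<open>The delicate point. The Hopf map is singular at 0, and smooth functions invariant under the
  circle are smooth functions of \<open>w\<close> and \<open>norm w\<close>, the second of which is not differentiable at
  0. What excludes \<open>norm w\<close> at first order is that the derivative of \<open>\<Psi>\<close> at 0 is unitary and thus
  descends to a linear map \<open>R\<close>. As the norm of \<open>hopf z\<close> is quadratic in \<open>z\<close>, the error \<open>o(\<bar>z\<bar>)\<close> upstairs
  becomes an error \<open>o(\<bar>w\<bar>)\<close> downstairs.\<close>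

lemma descended_differentiable_zero: "\<phi> differentiable (at 0)"
proof -
  obtain R where R: "linear R" "\<And>z. hopf (D 0 z) = R (hopf z)"
    using hopf_unitary[OF unitary_D_zero] by metis
  obtain K where K: "K > 0" "\<And>a b. norm (hopf_deriv a b) \<le> norm a * norm b * K"
    using bounded_bilinear.pos_bounded[OF bounded_bilinear_hopf_deriv] by blast
  have "(\<phi> has_derivative R) (at 0)"
    unfolding has_derivative_at_alt
  proof (intro conjI allI impI)
    show "bounded_linear R" using R(1) by (simp add: linear_conv_bounded_linear)
    fix \<epsilon> :: real assume "\<epsilon> > 0"
    define \<epsilon>' where "\<epsilon>' = \<epsilon> / (4 * K)"
    have "\<epsilon>' > 0" using \<open>\<epsilon> > 0\<close> K(1) by (simp add: \<epsilon>'_def)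
    then obtain d where d: "d > 0"
      "\<And>y. norm (y - 0) < d \<Longrightarrow> norm (\<Psi> y - \<Psi> 0 - D 0 (y - 0)) \<le> \<epsilon>' * norm (y - 0)"
      using has_derivative[of 0] unfolding has_derivative_at_alt by blast
    show "\<exists>d>0. \<forall>y. norm (y - 0) < d \<longrightarrow> norm (\<phi> y - \<phi> 0 - R (y - 0)) \<le> \<epsilon> * norm (y - 0)"
    proof (intro exI[of _ "d\<^sup>2 / 4"] conjI allI impI)
      fix w :: "real^3" assume w: "norm (w - 0) < d\<^sup>2 / 4"
      obtain z where z: "w = hopf z" using surj_hopf by metis
      have zw: "(norm z)\<^sup>2 = 4 * norm w" by (simp add: z norm_hopf)
      then have "(norm z)\<^sup>2 < d\<^sup>2" using w by simp
      then have "norm z < d" using d(1) by (simp add: power_less_imp_less_base)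
      then have near: "norm (\<Psi> z - D 0 z) \<le> \<epsilon>' * norm z" using d(2)[of z] by (simp add: zero)
      have n: "norm (D 0 z) = norm z"
        using unitary_D_zero by (simp add: unitary_def orthogonal_transformation_norm)
      have "\<phi> 0 = 0" using descended_norm[of 0] by simp
      then have "\<phi> w - \<phi> 0 - R (w - 0) = hopf (\<Psi> z) - hopf (D 0 z)"
        by (simp add: z descends R(2))
      also have "\<dots> = (1/2) *\<^sub>R hopf_deriv (\<Psi> z + D 0 z) (\<Psi> z - D 0 z)"
        by (rule hopf_diff)
      also have "norm \<dots> \<le> 1/2 * (norm (\<Psi> z + D 0 z) * norm (\<Psi> z - D 0 z) * K)"
        using K(2)[of "\<Psi> z + D 0 z" "\<Psi> z - D 0 z"] by simp
      also have "\<dots> \<le> 1/2 * ((2 * norm z) * (\<epsilon>' * norm z) * K)"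
        using near K(1) norm_triangle_ineq[of "\<Psi> z" "D 0 z"]
        by (intro mult_left_mono mult_right_mono mult_mono) (auto simp: norm_preserving n)
      also have "\<dots> = \<epsilon>' * K * (norm z)\<^sup>2" by (simp add: power2_eq_square)
      also have "\<dots> = \<epsilon> * norm (w - 0)" using K(1) by (simp add: zw \<epsilon>'_def)
      finally show "norm (\<phi> w - \<phi> 0 - R (w - 0)) \<le> \<epsilon> * norm (w - 0)" .
    qed (use d(1) in auto)
  qed
  then show ?thesis by (auto simp: differentiable_def)
qed

lemma descended_differentiable: "\<phi> differentiable (at w)"
proof (cases "w = 0")
  case True
  then show ?thesis using descended_differentiable_zero by simp
next
  case False
  then obtain \<sigma> where \<sigma>: "\<sigma> differentiable (at w)" "\<forall>\<^sub>F x in nhds w. hopf (\<sigma> x) = x"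
    using hopf_local_section by blast
  have "(hopf \<circ> (\<Psi> \<circ> \<sigma>)) differentiable (at w)"
    using \<sigma>(1) has_derivative[THEN differentiableI] differentiableI[OF has_derivative_hopf]
    by (intro differentiable_chain_at) auto
  then obtain f' where f': "((hopf \<circ> (\<Psi> \<circ> \<sigma>)) has_derivative f') (at w)"
    by (auto simp: differentiable_def)
  have ev: "\<forall>\<^sub>F x in nhds w. (hopf \<circ> (\<Psi> \<circ> \<sigma>)) x = \<phi> x"
    using \<sigma>(2) by eventually_elim (metis comp_apply descends)
  have "(\<phi> has_derivative f') (at w)"
  proof (rule has_derivative_transform_eventually[OF f'])
    show "\<forall>\<^sub>F x in at w. (hopf \<circ> (\<Psi> \<circ> \<sigma>)) x = \<phi> x"
      using ev by (auto simp: eventually_at_filter elim: eventually_mono)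
    show "(hopf \<circ> (\<Psi> \<circ> \<sigma>)) w = \<phi> w"
      using ev by (rule eventually_nhds_x_imp_x)
  qed simp
  then show ?thesis by (auto simp: differentiable_def)
qed

text \<open>Every point is a value of the Hopf map, so the bracket can be computed upstairs, where \<open>\<Psi>\<close> is a
  Poisson map.\<close>

lemma descended_preserves_lie_poisson: "preserves_lie_poisson \<phi>"
  unfolding preserves_lie_poisson_def
proof (intro conjI allI impI ext)
  show "\<phi> differentiable_on UNIV"
    using descended_differentiable by (simp add: differentiable_on_def)
  fix F G :: "real^3 \<Rightarrow> real" and w assume FG: "smooth F" "smooth G"
  obtain z where z: "w = hopf z" using surj_hopf by metis
  have g: "grad ((f \<circ> \<phi>) \<circ> hopf) z = adjoint (D z) (grad (f \<circ> hopf) (\<Psi> z))" if "smooth f" for f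
  proof -
    have "(f \<circ> \<phi>) \<circ> hopf = (f \<circ> hopf) \<circ> \<Psi>" by (auto simp: descends)
    then show ?thesis
      using grad_compose[OF has_derivative differentiable_compose_hopf] smooth_imp_differentiable[OF that]
      by metis
  qed
  have d: "(f \<circ> \<phi>) differentiable (at (hopf z))" if "smooth f" for f :: "real^3 \<Rightarrow> real"
    using smooth_imp_differentiable[OF that] descended_differentiable
    by (intro differentiable_chain_at)
  have "lp_bracket (F \<circ> \<phi>) (G \<circ> \<phi>) w =
      grad (F \<circ> hopf) (\<Psi> z) \<bullet> imul (grad (G \<circ> hopf) (\<Psi> z))"
    unfolding z lp_bracket_hopf[OF d[OF FG(1)] d[OF FG(2)]] g[OF FG(1)] g[OF FG(2)]
    by (rule symplectic_imp_poisson[OF linear_D canonical_form_D])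
  also have "\<dots> = lp_bracket F G (hopf (\<Psi> z))"
    using FG by (simp add: lp_bracket_hopf smooth_imp_differentiable)
  also have "\<dots> = (lp_bracket F G \<circ> \<phi>) w"
    by (simp add: z descends)
  finally show "lp_bracket (F \<circ> \<phi>) (G \<circ> \<phi>) w = (lp_bracket F G \<circ> \<phi>) w" .
qed

end

end

section \<open>The descended integrator\<close>

text \<open>Lift a point to phase space, make a Runge--Kutta step, and project. The choice of the lift is
  immaterial wherever the step is defined.\<close>

definition collective_rk ::
  "real^'s::finite^'s \<Rightarrow> real^'s \<Rightarrow> real \<Rightarrow> (real^3 \<Rightarrow> real) \<Rightarrow> real^3 \<Rightarrow> real^3" where
  "collective_rk A b h H w = hopf (rk_map A b (ham_vf (H \<circ> hopf)) h (SOME z. hopf z = w))"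

lemma rk_circle_equivariant:
  assumes "\<And>w. H differentiable (at w)" "cmod c = 1" "rk_defined A (ham_vf (H \<circ> hopf)) h z"
  shows "rk_map A b (ham_vf (H \<circ> hopf)) h (cmul c z) = cmul c (rk_map A b (ham_vf (H \<circ> hopf)) h z)"
proof -
  have "(H \<circ> hopf) \<circ> cmul c = H \<circ> hopf"
    using assms(2) by (auto simp: hopf_cmul)
  then show ?thesis
    using rk_unitary(2)[OF unitary_cmul[OF assms(2)], of "H \<circ> hopf" A h z b] assms(1,3)
    by (simp add: differentiable_compose_hopf)
qed

lemma collective_rk_hopf:
  assumes "\<And>w. H differentiable (at w)" "rk_defined A (ham_vf (H \<circ> hopf)) h z"
  shows "collective_rk A b h H (hopf z) = hopf (rk_map A b (ham_vf (H \<circ> hopf)) h z)"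
proof -
  have "hopf z = hopf (SOME z'. hopf z' = hopf z)"
    by (rule someI2[of _ z]) auto
  then obtain c where "cmod c = 1" "(SOME z'. hopf z' = hopf z) = cmul c z"
    by (rule hopf_eq_imp_cmul)
  then show ?thesis
    using rk_circle_equivariant[OF assms(1) _ assms(2)]
    by (simp add: collective_rk_def hopf_cmul)
qed

text \<open>A rotation lifts to a unitary map, with which the Runge--Kutta method commutes.\<close>

lemma collective_rk_rotation:
  fixes Q :: "real^3^3"
  assumes "\<And>w. H differentiable (at w)" "\<And>z. rk_defined A (ham_vf (H \<circ> hopf)) h z"
    "rotation_matrix Q"
  shows "Q *v collective_rk A b h (H \<circ> (*v) Q) w = collective_rk A b h H (Q *v w)"
proof -
  obtain U where U: "unitary U" "\<And>z. hopf (U z) = Q *v hopf z"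
    using rotation_lift[OF assms(3)] by blast
  have eq: "(H \<circ> (*v) Q) \<circ> hopf = (H \<circ> hopf) \<circ> U" by (auto simp: U(2))
  have d: "(H \<circ> hopf) differentiable (at z)" for z
    using assms(1) by (rule differentiable_compose_hopf)
  obtain z where z: "w = hopf z" using surj_hopf by metis
  have def: "rk_defined A (ham_vf ((H \<circ> (*v) Q) \<circ> hopf)) h z"
    unfolding eq rk_unitary(1)[OF U(1) d] by (rule assms(2))
  have dQ: "(H \<circ> (*v) Q) differentiable (at x)" for x
    using assms(1) by (intro differentiable_chain_at) (auto simp: linear_imp_differentiable)
  have "Q *v collective_rk A b h (H \<circ> (*v) Q) w =
      hopf (U (rk_map A b (ham_vf ((H \<circ> hopf) \<circ> U)) h z))"
    unfolding z collective_rk_hopf[OF dQ def] U(2) eq ..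
  also have "\<dots> = hopf (rk_map A b (ham_vf (H \<circ> hopf)) h (U z))"
    using rk_unitary(2)[OF U(1) d def[unfolded eq], of b] by simp
  also have "\<dots> = collective_rk A b h H (Q *v w)"
    using collective_rk_hopf[of H A h "U z" b] assms(1,2) by (simp add: z U(2))
  finally show ?thesis .
qed

text \<open>The exact flow descends as well, and \<open>hopf\<close> is Lipschitz on bounded sets, so errors on phase
  space bound the errors on \<open>\<real>\<^sup>3\<close> from above.\<close>

lemma collective_rk_order:
  fixes A :: "real^'s::finite^'s"
  assumes "smooth H" "integrator_of_order k (rk_map A b (ham_vf (H \<circ> hopf))) (ham_vf (H \<circ> hopf))"
  shows "integrator_of_order k (\<lambda>h. collective_rk A b h H) (lp_vf H)"
  unfolding integrator_of_order_def
proof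
  fix w
  let ?X = "ham_vf (H \<circ> hopf)"
  obtain z where z: "w = hopf z" using surj_hopf by metis
  obtain v where v: "integral_curve ?X z v"
    and ord: "(\<lambda>h. norm (rk_map A b ?X h z - v h)) \<in> O[at 0](\<lambda>h. h ^ (k + 1))"
    using assms(2) unfolding integrator_of_order_def by blast
  from v obtain \<epsilon> where \<epsilon>: "v 0 = z" "\<epsilon> > 0"
    "\<And>t. t \<in> {-\<epsilon><..<\<epsilon>} \<Longrightarrow> (v has_vector_derivative ?X (v t)) (at t)"
    unfolding integral_curve_def by blast
  have Hd: "H differentiable (at x)" for x
    using assms(1) by (rule smooth_imp_differentiable)
  have curve: "integral_curve (lp_vf H) w (\<lambda>t. hopf (v t))"
    unfolding integral_curve_def
  proof (intro conjI exI[of _ \<epsilon>] ballI)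
    fix t assume "t \<in> {-\<epsilon><..<\<epsilon>}"
    then have "((hopf \<circ> v) has_vector_derivative hopf_deriv (v t) (?X (v t))) (at t)"
      using \<epsilon>(3) has_derivative_hopf vector_derivative_diff_chain_within[of v _ t UNIV hopf]
      by (metis has_derivative_at_withinI)
    then show "((\<lambda>t. hopf (v t)) has_vector_derivative lp_vf H (hopf (v t))) (at t)"
      unfolding hopf_related_vector_fields[OF Hd] by (simp add: o_def)
  qed (simp_all add: z \<epsilon>)
  have "(v \<longlongrightarrow> v 0) (at 0)"
    using \<epsilon>(2) has_vector_derivative_continuous[OF \<epsilon>(3)[of 0]] by (simp add: isCont_def)
  then have v1: "(\<lambda>h. norm (v h)) \<in> O[at 0](\<lambda>h. 1)"
    by (intro bigoI_tendsto[where c = "norm (v 0)"]) (auto intro: tendsto_norm)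
  have p1: "(\<lambda>h::real. h ^ (k + 1)) \<in> O[at 0](\<lambda>h. 1)"
    by (rule bigoI_tendsto[where c = "0 ^ (k + 1)"]) (auto intro!: tendsto_eq_intros)
  obtain K where K: "K > 0" "\<And>a b. norm (hopf_deriv a b) \<le> norm a * norm b * K"
    using bounded_bilinear.pos_bounded[OF bounded_bilinear_hopf_deriv] by blast
  let ?e = "\<lambda>h. norm (rk_map A b ?X h z - v h)"
  have g: "(\<lambda>h. K * (?e h * (?e h + 2 * norm (v h)))) \<in> O[at 0](\<lambda>h. h ^ (k + 1) * 1)"
    by (intro landau_o.big.cmult_in_iff[THEN iffD2] landau_o.big.mult ord sum_in_bigo
        landau_o.big_trans[OF ord p1] v1) (use K in auto)
  have le: "norm (hopf (rk_map A b ?X h z) - hopf (v h)) \<le> K * (?e h * (?e h + 2 * norm (v h)))" for h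
  proof -
    let ?x = "rk_map A b ?X h z"
    have "norm (hopf ?x - hopf (v h)) \<le> norm (hopf_deriv (?x + v h) (?x - v h))"
      by (simp add: hopf_diff)
    also have "\<dots> \<le> norm (?x + v h) * norm (?x - v h) * K"
      by (rule K(2))
    also have "\<dots> \<le> (?e h + 2 * norm (v h)) * ?e h * K"
    proof -
      have eq: "?x + v h = (?x - v h) + 2 *\<^sub>R v h" by (simp add: scaleR_2)
      have "norm (?x + v h) \<le> ?e h + 2 * norm (v h)"
        unfolding eq by (rule order_trans[OF norm_triangle_ineq]) simp
      then show ?thesis
        using K(1) by (intro mult_right_mono) auto
    qed
    finally show ?thesis by (simp only: mult_ac)
  qed
  have bound: "(\<lambda>h. norm (hopf (rk_map A b ?X h z) - hopf (v h))) \<in> O[at 0](\<lambda>h. h ^ (k + 1))"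
    by (rule landau_o.big_trans[OF landau_o.big_mono g[unfolded mult_1_right]])
      (use le K(1) in \<open>simp add: abs_mult abs_of_nonneg\<close>)
  obtain L where L: "L-lipschitz_on (cball z 1) ?X"
    using ham_vf_lipschitz smooth_compose_hopf[OF assms(1)] by metis
  obtain h0 where h0: "h0 > 0" "\<And>h. \<bar>h\<bar> \<le> h0 \<Longrightarrow> rk_defined A ?X h z"
    using rk_locally_defined[OF L, of A] by metis
  have "\<forall>\<^sub>F h in at 0. \<bar>h\<bar> \<le> h0"
    unfolding eventually_at using h0(1) by (intro exI[of _ h0]) (auto simp: dist_norm)
  then have cong: "\<forall>\<^sub>F h in at 0. norm (hopf (rk_map A b ?X h z) - hopf (v h)) =
      norm (collective_rk A b h H w - hopf (v h))"
    by eventually_elim (simp add: z collective_rk_hopf Hd h0(2))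
  have "(\<lambda>h. norm (collective_rk A b h H w - hopf (v h))) \<in> O[at 0](\<lambda>h. h ^ (k + 1))"
    by (rule landau_o.big.in_cong[OF cong, THEN iffD1, OF bound])
  with curve show "\<exists>u. integral_curve (lp_vf H) w u \<and>
      (\<lambda>h. norm (collective_rk A b h H w - u h)) \<in> O[at 0](\<lambda>h. h ^ (k + 1))"
    by (intro exI[of _ "\<lambda>t. hopf (v t)"] conjI)
qed

lemma collective_rk_consistent:
  assumes "smooth H" "(\<Sum>i\<in>UNIV. b $ i) = 1"
  shows "consistent_integrator (\<lambda>h. collective_rk A b h H) (lp_vf H)"
proof -
  have "integrator_of_order 1 (rk_map A b (ham_vf (H \<circ> hopf))) (ham_vf (H \<circ> hopf))"
    by (rule rk_consistent[OF _ assms(2)]) (metis ham_vf_lipschitz smooth_compose_hopf assms(1))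
  then show ?thesis
    unfolding consistent_integrator_def using collective_rk_order[OF assms(1)] by blast
qed

theorem theorem2p1:
  fixes A :: "real^'s::finite^'s" and b :: "real^'s"
  assumes "(\<Sum>i\<in>UNIV. b $ i) = 1"
    and "rk_symplectic TYPE(2) A b"
  shows "\<exists>\<phi> :: real \<Rightarrow> (real^3 \<Rightarrow> real) \<Rightarrow> real^3 \<Rightarrow> real^3.
    \<forall>H. smooth H \<longrightarrow>
      (\<forall>h z. rk_defined A (ham_vf (H \<circ> hopf)) h z \<longrightarrow>
         \<phi> h H (hopf z) = hopf (rk_map A b (ham_vf (H \<circ> hopf)) h z)) \<and>
      (\<forall>h. rk_admissible A (ham_vf (H \<circ> hopf)) h \<longrightarrow>
         \<phi> h H \<circ> hopf = hopf \<circ> rk_map A b (ham_vf (H \<circ> hopf)) h \<and>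
         preserves_lie_poisson (\<phi> h H) \<and>
         preserves_coadjoint_orbits (\<phi> h H) \<and>
         (\<forall>R g. rotation_matrix R \<longrightarrow> g = (\<lambda>w. R *v w) \<longrightarrow>
            \<phi> h (H \<circ> g) = inv g \<circ> \<phi> h H \<circ> g)) \<and>
      consistent_integrator (\<lambda>h. \<phi> h H) (lp_vf H) \<and>
      (\<forall>k. integrator_of_order k (rk_map A b (ham_vf (H \<circ> hopf))) (ham_vf (H \<circ> hopf)) \<longrightarrow>
         integrator_of_order k (\<lambda>h. \<phi> h H) (lp_vf H))"
proof (rule exI[of _ "collective_rk A b"], intro allI impI conjI)
  fix H :: "real^3 \<Rightarrow> real" assume H: "smooth H"
  have Hd: "H differentiable (at w)" for w
    using H by (rule smooth_imp_differentiable)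
  show hopf: "collective_rk A b h H (hopf z) = hopf (rk_map A b (ham_vf (H \<circ> hopf)) h z)"
    if "rk_defined A (ham_vf (H \<circ> hopf)) h z" for h z
    using Hd that by (rule collective_rk_hopf)
  show "consistent_integrator (\<lambda>h. collective_rk A b h H) (lp_vf H)"
    using H assms(1) by (rule collective_rk_consistent)
  show "integrator_of_order k (\<lambda>h. collective_rk A b h H) (lp_vf H)"
    if "integrator_of_order k (rk_map A b (ham_vf (H \<circ> hopf))) (ham_vf (H \<circ> hopf))" for k
    using H that by (rule collective_rk_order)
  fix h assume adm: "rk_admissible A (ham_vf (H \<circ> hopf)) h"
  then have def: "rk_defined A (ham_vf (H \<circ> hopf)) h z" for z
    by (simp add: rk_admissible_def)
  have desc: "collective_rk A b h H (hopf z) = hopf (rk_map A b (ham_vf (H \<circ> hopf)) h z)" for z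
    using def by (rule hopf)
  then show "collective_rk A b h H \<circ> hopf = hopf \<circ> rk_map A b (ham_vf (H \<circ> hopf)) h"
    by auto
  interpret circle_symplectic "rk_map A b (ham_vf (H \<circ> hopf)) h"
  proof
    show "symplectic_map (rk_map A b (ham_vf (H \<circ> hopf)) h)"
      using assms(2) smooth_compose_hopf[OF H] adm by (auto simp: rk_symplectic_def)
    show "cmod c = 1 \<Longrightarrow> rk_map A b (ham_vf (H \<circ> hopf)) h (cmul c z) =
        cmul c (rk_map A b (ham_vf (H \<circ> hopf)) h z)" for c z
      using rk_circle_equivariant[OF Hd _ def] .
  qed
  show "preserves_lie_poisson (collective_rk A b h H)"
    using desc by (rule descended_preserves_lie_poisson)
  show "preserves_coadjoint_orbits (collective_rk A b h H)"
    using desc by (rule descended_preserves_coadjoint_orbits)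
  fix R :: "real^3^3" and g assume R: "rotation_matrix R" and g: "g = (\<lambda>w. R *v w)"
  have "orthogonal_transformation g"
    using R by (simp add: g rotation_matrix_def orthogonal_transformation_matrix)
  then have "inj g" by (rule orthogonal_transformation_inj)
  moreover have "g (collective_rk A b h (H \<circ> g) w) = collective_rk A b h H (g w)" for w
    unfolding g using collective_rk_rotation[OF Hd def R] by simp
  ultimately show "collective_rk A b h (H \<circ> g) = inv g \<circ> collective_rk A b h H \<circ> g"
    by (metis (no_types, lifting) comp_apply ext inv_f_f)
qed

end
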